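(* Let $A_1=-\frac{3}{10}$, $A_2=\frac12$, $A_{1,2}=A_1-A_2=-\frac45$, and let $\Gamma\neq 0$ be real. Consider the system of ordinary differential equations for the real variables $(\omega_1,\omega_2,\omega_3,\omega_4,\omega_p)\in\mathbb{R}^5$: \begin{align*} \dot\omega_1&=-A_2\,\omega_p\,\omega_2,\\ \dot\omega_2&=A_1\,\omega_p\,\omega_1-A_2\,\omega_p\,\omega_3,\\ \dot\omega_3&=A_2\,\omega_p\,\omega_2-A_1\,\omega_p\,\omega_4,\\ \dot\omega_4&=A_2\,\omega_p\,\omega_3,\\ \dot\omega_p&=A_{1,2}\,(\omega_3\omega_4-\omega_1\omega_2). \end{align*} Let $\omega^*$ denote the fixed point $\omega_p=\Gamma$, $\omega_1=\omega_2=\omega_3=\omega_4=0$, and let $-\omega^*$ denote the fixed point $\omega_p=-\Gamma$, $\omega_1=\omega_2=\omega_3=\omega_4=0$. Write $$\omega_1=r\cos\theta,\quad \omega_4=r\sin\theta,\quad \omega_2=\rho\cos\vartheta,\quad \omega_3=\rho\sin\vartheta .$$ Then the stable and unstable manifolds of $\omega^*$ and of $-\omega^*$ (apart from the fixed points $\pm\omega^*$ themselves) are two-dimensional and consist of the following orbits, which are asymptotic to the line of fixed points $\{\omega_1=\omega_2=\omega_3=\omega_4=0\}$ and are parametrized by $(\tau_0,\theta_0)\in\mathbb{R}^2$ for each of the two choices of sign of $\kappa$: \begin{align*} \omega_p&=\Gamma\tanh\tau,\\ r&=\sqrt{\frac{A_2}{A_2-A_1}}\;\Gamma\,\operatorname{sech}\tau,\\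 \theta&=-\frac{A_2}{2\kappa}\ln\cosh\tau+\theta_0,\\ \rho&=\sqrt{\frac{-A_1}{A_2}}\;r,\\ \theta+\vartheta&=\begin{cases}-\arcsin\left[\frac12\sqrt{\frac{A_2}{-A_1}}\right], & \kappa>0,\\[1ex] \pi+\arcsin\left[\frac12\sqrt{\frac{A_2}{-A_1}}\right], & \kappa<0,\end{cases} \end{align*} where $\tau=\kappa\Gamma t+\tau_0$ and $$\kappa=\sqrt{-A_1A_2}\,\cos(\theta+\vartheta)=\pm\sqrt{-A_1A_2}\,\sqrt{1+\frac{A_2}{4A_1}} .$$ Moreover, along these orbits the two auxiliary variables $\omega_0,\omega_5$, governed by the decoupled equations $\dot\omega_0=-A_1\omega_p\omega_1$ and $\dot\omega_5=A_1\omega_p\omega_4$ and tending to $0$ as $t\to\pm\infty$, have the expressions \begin{align*} \omega_0&=\frac{\alpha\beta}{1+\beta^2}\operatorname{sech}\tau\left\{\sin[\beta\ln\cosh\tau+\theta_0]-\frac1\beta\cos[\beta\ln\cosh\tau+\theta_0]\right\},\\ \omega_5&=\frac{\alpha\beta}{1+\beta^2}\operatorname{sech}\tau\left\{\cos[\beta\ln\cosh\tau+\theta_0]+\frac1\beta\sin[\beta\ln\cosh\tau+\theta_0]\right\}, \end{align*} where $\alpha=-A_1\Gamma\kappa^{-1}\sqrt{\frac{A_2}{A_2-A_1}}$ and $\beta=-\frac{A_2}{2\kappa}$.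
   Context: The system is a Galerkin truncation of the 2D Euler equation (vorticity form, cosine Fourier series with real coefficients $\omega_k$) to the modes $p=(1,1)^T$ and $\hat k+np$, $n=1,\dots,4$, with $\hat k=(-3,-2)^T$, where $\omega_n$ abbreviates $\omega_{\hat k+np}$; $\omega_0$ and $\omega_5$ are two further modes which do not feed back into the five-dimensional system. The stable (respectively unstable) manifold of a fixed point is the set of initial points whose orbits converge (exponentially) to that fixed point as $t\to+\infty$ (respectively $t\to-\infty$). The pair $(r,\theta)$ and the pair $(\rho,\vartheta)$ are polar coordinates in which $r$ and $\rho$ are allowed to be negative (they have the sign of $\Gamma$ in the formulas). *)

theory Defs
  imports "HOL-Analysis.Analysis"
begin

definition A1 :: real where "A1 = - 3 / 10"
definition A2 :: real where "A2 = 1 / 2"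
definition A12 :: real where "A12 = A1 - A2"

text \<open>Phase space \<open>\<real>\<^sup>5\<close>, coordinates in the order
  \<open>(\<omega>\<^sub>1, \<omega>\<^sub>2, \<omega>\<^sub>3, \<omega>\<^sub>4, \<omega>\<^sub>p)\<close>; the product type carries the Euclidean norm.\<close>

type_synonym phase = "real \<times> real \<times> real \<times> real \<times> real"

definition euler_field :: "phase \<Rightarrow> phase" where
  "euler_field = (\<lambda>(w1, w2, w3, w4, wp).
     ( - A2 * wp * w2,
       A1 * wp * w1 - A2 * wp * w3,
       A2 * wp * w2 - A1 * wp * w4,
       A2 * wp * w3,
       A12 * (w3 * w4 - w1 * w2)))"

definition aux_field0 :: "phase \<Rightarrow> real" where
  "aux_field0 = (\<lambda>(w1, w2, w3, w4, wp). - A1 * wp * w1)"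

definition aux_field5 :: "phase \<Rightarrow> real" where
  "aux_field5 = (\<lambda>(w1, w2, w3, w4, wp). A1 * wp * w4)"

definition equilibrium :: "real \<Rightarrow> phase" where
  "equilibrium \<Gamma> = (0, 0, 0, 0, \<Gamma>)"

definition fixed_line :: "phase set" where
  "fixed_line = {(w1, w2, w3, w4, wp). w1 = 0 \<and> w2 = 0 \<and> w3 = 0 \<and> w4 = 0}"

definition solves :: "('a::real_normed_vector \<Rightarrow> 'a) \<Rightarrow> (real \<Rightarrow> 'a) \<Rightarrow> real set \<Rightarrow> bool" where
  "solves F x T \<longleftrightarrow> (\<forall>t\<in>T. (x has_vector_derivative F (x t)) (at t within T))"

definition stable_manifold :: "('a::real_normed_vector \<Rightarrow> 'a) \<Rightarrow> 'a \<Rightarrow> 'a set" where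
  "stable_manifold F q = {x 0 | x. solves F x {0..} \<and> (x \<longlongrightarrow> q) at_top}"

definition unstable_manifold :: "('a::real_normed_vector \<Rightarrow> 'a) \<Rightarrow> 'a \<Rightarrow> 'a set" where
  "unstable_manifold F q = {x 0 | x. solves F x {..0} \<and> (x \<longlongrightarrow> q) at_bot}"

text \<open>Embedded two-dimensional \<open>C\<^sup>1\<close> submanifold without boundary: near each of its points,
  \<open>S\<close> is the homeomorphic image of an open subset of the plane under a \<open>C\<^sup>1\<close> immersion.\<close>

definition two_dim_submanifold :: "'a::euclidean_space set \<Rightarrow> bool" where
  "two_dim_submanifold S \<longleftrightarrow>
     (\<forall>p\<in>S. \<exists>U (V :: (real \<times> real) set) \<phi> \<psi> (\<phi>' :: real \<times> real \<Rightarrow> (real \<times> real) \<Rightarrow>\<^sub>L 'a).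
        open U \<and> p \<in> U \<and> open V \<and> homeomorphism V (S \<inter> U) \<phi> \<psi> \<and>
        (\<forall>v\<in>V. (\<phi> has_derivative blinfun_apply (\<phi>' v)) (at v) \<and> inj (blinfun_apply (\<phi>' v))) \<and>
        continuous_on V \<phi>')"

definition sech :: "real \<Rightarrow> real" where
  "sech x = 1 / cosh x"

definition kappa_abs :: real where
  "kappa_abs = sqrt (- A1 * A2) * sqrt (1 + A2 / (4 * A1))"

definition tau :: "real \<Rightarrow> real \<Rightarrow> real \<Rightarrow> real \<Rightarrow> real" where
  "tau \<Gamma> \<kappa> \<tau>0 t = \<kappa> * \<Gamma> * t + \<tau>0"

text \<open>Polar coordinates along the orbits; the radii \<open>orb_r\<close>, \<open>orb_rho\<close> are signed
  (they have the sign of \<open>\<Gamma>\<close>).\<close>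

definition orb_r :: "real \<Rightarrow> real \<Rightarrow> real \<Rightarrow> real \<Rightarrow> real" where
  "orb_r \<Gamma> \<kappa> \<tau>0 t = sqrt (A2 / (A2 - A1)) * \<Gamma> * sech (tau \<Gamma> \<kappa> \<tau>0 t)"

definition orb_theta :: "real \<Rightarrow> real \<Rightarrow> real \<Rightarrow> real \<Rightarrow> real \<Rightarrow> real" where
  "orb_theta \<Gamma> \<kappa> \<tau>0 \<theta>0 t = - A2 / (2 * \<kappa>) * ln (cosh (tau \<Gamma> \<kappa> \<tau>0 t)) + \<theta>0"

definition orb_rho :: "real \<Rightarrow> real \<Rightarrow> real \<Rightarrow> real \<Rightarrow> real" where
  "orb_rho \<Gamma> \<kappa> \<tau>0 t = sqrt (- A1 / A2) * orb_r \<Gamma> \<kappa> \<tau>0 t"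

text \<open>The constant value of \<open>\<theta> + \<vartheta>\<close>; only used for \<open>\<kappa> \<noteq> 0\<close>.\<close>

definition angle_sum :: "real \<Rightarrow> real" where
  "angle_sum \<kappa> = (if \<kappa> > 0 then - arcsin (1 / 2 * sqrt (A2 / - A1))
                  else pi + arcsin (1 / 2 * sqrt (A2 / - A1)))"

definition orb_vartheta :: "real \<Rightarrow> real \<Rightarrow> real \<Rightarrow> real \<Rightarrow> real \<Rightarrow> real" where
  "orb_vartheta \<Gamma> \<kappa> \<tau>0 \<theta>0 t = angle_sum \<kappa> - orb_theta \<Gamma> \<kappa> \<tau>0 \<theta>0 t"

definition orb :: "real \<Rightarrow> real \<Rightarrow> real \<Rightarrow> real \<Rightarrow> real \<Rightarrow> phase" where
  "orb \<Gamma> \<kappa> \<tau>0 \<theta>0 t =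
     ( orb_r \<Gamma> \<kappa> \<tau>0 t * cos (orb_theta \<Gamma> \<kappa> \<tau>0 \<theta>0 t),
       orb_rho \<Gamma> \<kappa> \<tau>0 t * cos (orb_vartheta \<Gamma> \<kappa> \<tau>0 \<theta>0 t),
       orb_rho \<Gamma> \<kappa> \<tau>0 t * sin (orb_vartheta \<Gamma> \<kappa> \<tau>0 \<theta>0 t),
       orb_r \<Gamma> \<kappa> \<tau>0 t * sin (orb_theta \<Gamma> \<kappa> \<tau>0 \<theta>0 t),
       \<Gamma> * tanh (tau \<Gamma> \<kappa> \<tau>0 t))"

definition orbit_family :: "real \<Rightarrow> real \<Rightarrow> phase set" where
  "orbit_family \<Gamma> \<kappa> = (\<Union>\<tau>0. \<Union>\<theta>0. range (orb \<Gamma> \<kappa> \<tau>0 \<theta>0))"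

definition aux_alpha :: "real \<Rightarrow> real \<Rightarrow> real" where
  "aux_alpha \<Gamma> \<kappa> = - A1 * \<Gamma> * inverse \<kappa> * sqrt (A2 / (A2 - A1))"

definition aux_beta :: "real \<Rightarrow> real" where
  "aux_beta \<kappa> = - A2 / (2 * \<kappa>)"

definition omega0 :: "real \<Rightarrow> real \<Rightarrow> real \<Rightarrow> real \<Rightarrow> real \<Rightarrow> real" where
  "omega0 \<Gamma> \<kappa> \<tau>0 \<theta>0 t =
     (let \<alpha> = aux_alpha \<Gamma> \<kappa>; \<beta> = aux_beta \<kappa>; \<tau> = tau \<Gamma> \<kappa> \<tau>0 t in
      \<alpha> * \<beta> / (1 + \<beta>\<^sup>2) * sech \<tau> *
      (sin (\<beta> * ln (cosh \<tau>) + \<theta>0) - 1 / \<beta> * cos (\<beta> * ln (cosh \<tau>) + \<theta>0)))"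

definition omega5 :: "real \<Rightarrow> real \<Rightarrow> real \<Rightarrow> real \<Rightarrow> real \<Rightarrow> real" where
  "omega5 \<Gamma> \<kappa> \<tau>0 \<theta>0 t =
     (let \<alpha> = aux_alpha \<Gamma> \<kappa>; \<beta> = aux_beta \<kappa>; \<tau> = tau \<Gamma> \<kappa> \<tau>0 t in
      \<alpha> * \<beta> / (1 + \<beta>\<^sup>2) * sech \<tau> *
      (cos (\<beta> * ln (cosh \<tau>) + \<theta>0) + 1 / \<beta> * sin (\<beta> * ln (cosh \<tau>) + \<theta>0)))"

end

theory Submission imports Defs begin

text \<open>Put \<open>z = \<omega>\<^sub>1 + i\<omega>\<^sub>4\<close> and \<open>u = \<omega>\<^sub>2 - i\<omega>\<^sub>3\<close>. Up to the scalar factor \<open>\<omega>\<^sub>p\<close> the first four equations are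
  the constant linear system \<open>z' = -A\<^sub>2 u\<close>, \<open>u' = A\<^sub>1 z - i A\<^sub>2 u\<close>, whose eigenvalues are
  \<open>\<plusminus>\<kappa> - i A\<^sub>2/2\<close> with \<open>\<kappa>\<^sup>2 = -A\<^sub>1A\<^sub>2 - A\<^sub>2\<^sup>2/4 = 7/80\<close>. Hence the component of \<open>(z, u)\<close> along the
  eigenvector for \<open>+\<kappa>\<close> has a squared modulus obeying \<open>f' = 2\<kappa>\<omega>\<^sub>p f\<close>. A solution converging to
  \<open>(0, 0, 0, 0, c)\<close> with \<open>\<kappa>c > 0\<close> must have \<open>f = 0\<close> throughout, since \<open>f\<close> would grow otherwise
  (\<open>unstable_rate_forces_zero\<close>): it stays in the eigenspace for \<open>-\<kappa>\<close>, that is,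
  \<open>A\<^sub>2 u = (\<kappa> + i A\<^sub>2/2) z\<close>. The quadratic first integral \<open>\<omega>\<^sub>p\<^sup>2 + (8/5)|z|\<^sup>2\<close> equals \<open>c\<^sup>2\<close> in the limit.
  So the stable manifold lies on an ellipsoid inside a three-dimensional linear space, and misses
  only the opposite pole \<open>(0, 0, 0, 0, -c)\<close>, which is itself an equilibrium
  (\<open>stable_manifold_eq\<close>).

  Conversely, on the ellipsoid \<open>\<omega>\<^sub>p' = \<kappa>(c\<^sup>2 - \<omega>\<^sub>p\<^sup>2)\<close> and \<open>z' = (-\<kappa> - i A\<^sub>2/2) \<omega>\<^sub>p z\<close>, which integrate to
  the hyperbolic formulas of the statement; these orbits sweep out the ellipsoid without its two
  poles (\<open>orbit_family_eq\<close>). Unstable manifolds are stable manifolds of the opposite equilibrium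
  under the reversing symmetry \<open>t \<mapsto> -t\<close>, \<open>\<omega>\<^sub>p \<mapsto> -\<omega>\<^sub>p\<close>
  (\<open>unstable_manifold_eq_reversed\<close>). Stereographic projection from the missing pole is a global
  chart of the manifold (\<open>two_dim_punctured_ellipsoid\<close>), and the exponential rate comes from
  \<open>(|z|\<^sup>2)' = -2\<kappa>\<omega>\<^sub>p |z|\<^sup>2\<close>.\<close>

section \<open>Scalar linear equations on a half-line\<close>

text \<open>Multiplying by the integrating factor \<open>exp (- \<integral> g)\<close> turns \<open>f\<close> into a constant, so a zero at one time
  is a zero at all times, earlier ones included.\<close>

lemma linear_ode_zero_propagates:
  fixes f g :: "real \<Rightarrow> real"
  assumes f: "\<And>t. t \<ge> 0 \<Longrightarrow> (f has_real_derivative g t * f t) (at t within {0..})"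
    and g: "continuous_on {0..} g"
    and zero: "T \<ge> 0" "f T = 0" and s: "s \<ge> 0"
  shows "f s = 0"
proof -
  define M where "M = max T s"
  have "continuous_on {0..M} g"
    using g by (rule continuous_on_subset) auto
  then obtain G where G: "\<And>t. t \<in> {0..M} \<Longrightarrow> (G has_vector_derivative g t) (at t within {0..M})"
    using antiderivative_continuous[of 0 M g] by metis
  have const: "((\<lambda>t. f t * exp (- G t)) has_real_derivative 0) (at t within {0..M})" if "t \<in> {0..M}" for t
  proof -
    have "(G has_real_derivative g t) (at t within {0..M})"
      using G[OF that] by (simp add: has_real_derivative_iff_has_vector_derivative)
    moreover have "(f has_real_derivative g t * f t) (at t within {0..M})"
      using that by (intro DERIV_subset[OF f]) auto
    ultimately show ?thesis
      by (auto intro!: derivative_eq_intros)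
  qed
  have "\<exists>k. \<forall>t\<in>{0..M}. f t * exp (- G t) = k"
    by (rule has_field_derivative_zero_constant[OF _ const]) auto
  then have "f s * exp (- G s) = f T * exp (- G T)"
    using zero(1) s by (auto simp: M_def)
  then show ?thesis
    using zero(2) by simp
qed

lemma DERIV_half_line:
  fixes f :: "real \<Rightarrow> real"
  assumes "(f has_real_derivative d) (at t within {0..})" "t > 0"
  shows "(f has_real_derivative d) (at t)"
proof -
  have "at t within {0..} = at t"
    using assms(2) by (intro at_within_interior) simp
  with assms(1) show ?thesis by simp
qed

text \<open>Once \<open>g\<close> is positive the nonnegative \<open>f\<close> is nondecreasing, so tending to \<open>0\<close> it must already vanish
  there; that zero then spreads back to time \<open>0\<close>.\<close>

lemma unstable_rate_forces_zero:
  fixes f g :: "real \<Rightarrow> real"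
  assumes f: "\<And>t. t \<ge> 0 \<Longrightarrow> (f has_real_derivative g t * f t) (at t within {0..})"
    and g: "continuous_on {0..} g"
    and nonneg: "\<And>t. t \<ge> 0 \<Longrightarrow> f t \<ge> 0"
    and f0: "(f \<longlongrightarrow> 0) at_top" and gl: "(g \<longlongrightarrow> l) at_top" "l > 0"
    and s: "s \<ge> 0"
  shows "f s = 0"
proof -
  have "eventually (\<lambda>t. g t > 0) at_top"
    using gl by (simp add: order_tendstoD)
  then obtain T0 where T0: "\<And>t. t \<ge> T0 \<Longrightarrow> g t > 0"
    by (auto simp: eventually_at_top_linorder)
  define T where "T = max 1 T0"
  have mono: "f T \<le> f t" if "t \<ge> T" for t
  proof (rule DERIV_nonneg_imp_nondecreasing[OF that])
    fix x assume x: "T \<le> x" "x \<le> t"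
    then have "(f has_real_derivative g x * f x) (at x)"
      by (intro DERIV_half_line f) (auto simp: T_def)
    moreover have "g x * f x \<ge> 0"
      using x T0[of x] nonneg[of x] by (auto simp: T_def intro!: mult_nonneg_nonneg)
    ultimately show "\<exists>y. (f has_real_derivative y) (at x) \<and> 0 \<le> y" by blast
  qed
  have "f T \<le> 0"
    using f0 eventually_mono[OF eventually_ge_at_top[of T] mono]
    by (intro tendsto_lowerbound[where f = f and F = at_top]) auto
  with nonneg[of T] have "f T = 0" by (simp add: T_def)
  then show ?thesis
    using linear_ode_zero_propagates[of f g T s] f g s by (auto simp: T_def)
qed

text \<open>The function \<open>f t * exp (b * t)\<close> is nonincreasing as soon as \<open>g\<close> lies below \<open>-b\<close>.\<close>

lemma stable_rate_exponential_decay: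
  fixes f g :: "real \<Rightarrow> real"
  assumes f: "\<And>t. t \<ge> 0 \<Longrightarrow> (f has_real_derivative g t * f t) (at t within {0..})"
    and nonneg: "\<And>t. t \<ge> 0 \<Longrightarrow> f t \<ge> 0"
    and gl: "(g \<longlongrightarrow> - l) at_top" "l > b"
  shows "\<exists>C. eventually (\<lambda>t. f t \<le> C * exp (- b * t)) at_top"
proof -
  have "eventually (\<lambda>t. g t < - b) at_top"
    using gl by (simp add: order_tendstoD)
  then obtain T0 where T0: "\<And>t. t \<ge> T0 \<Longrightarrow> g t < - b"
    by (auto simp: eventually_at_top_linorder)
  define T where "T = max 1 T0"
  have mono: "f t * exp (b * t) \<le> f T * exp (b * T)" if "t \<ge> T" for t
  proof (rule DERIV_nonpos_imp_nonincreasing[OF that])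
    fix x assume x: "T \<le> x" "x \<le> t"
    then have "(f has_real_derivative g x * f x) (at x)"
      by (intro DERIV_half_line f) (auto simp: T_def)
    then have "((\<lambda>t. f t * exp (b * t)) has_real_derivative (g x + b) * (f x * exp (b * x))) (at x)"
      by (auto intro!: derivative_eq_intros simp: algebra_simps)
    moreover have "(g x + b) * (f x * exp (b * x)) \<le> 0"
      using x T0[of x] nonneg[of x] by (auto simp: T_def intro!: mult_nonpos_nonneg)
    ultimately show "\<exists>y. ((\<lambda>t. f t * exp (b * t)) has_real_derivative y) (at x) \<and> y \<le> 0" by blast
  qed
  have "f t \<le> (f T * exp (b * T)) * exp (- b * t)" if "t \<ge> T" for t
    using mult_right_mono[OF mono[OF that], of "exp (- b * t)"]
    by (simp add: mult.assoc flip: exp_add)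
  then show ?thesis
    by (auto simp: eventually_at_top_linorder)
qed

lemma eventual_exponential_bound_global:
  fixes f :: "real \<Rightarrow> real"
  assumes "continuous_on {0..} f"
    and "eventually (\<lambda>t. f t \<le> C * exp (- b * t)) at_top"
  shows "\<exists>C'. \<forall>t\<ge>0. f t \<le> C' * exp (- b * t)"
proof -
  obtain T where T: "\<And>t. t \<ge> T \<Longrightarrow> f t \<le> C * exp (- b * t)"
    using assms(2) by (auto simp: eventually_at_top_linorder)
  have "continuous_on {0..T} (\<lambda>t. f t * exp (b * t))"
    by (intro continuous_intros continuous_on_subset[OF assms(1)]) auto
  then have "bounded ((\<lambda>t. f t * exp (b * t)) ` {0..T})"
    by (intro compact_imp_bounded compact_continuous_image) auto
  then obtain B where B: "\<And>t. t \<in> {0..T} \<Longrightarrow> \<bar>f t * exp (b * t)\<bar> \<le> B"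
    unfolding bounded_iff ball_simps real_norm_def by metis
  have "f t \<le> max B C * exp (- b * t)" if "t \<ge> 0" for t
  proof (cases "t \<le> T")
    case True
    then have "f t * exp (b * t) \<le> B" using B[of t] that by auto
    then have "f t * exp (b * t) * exp (- b * t) \<le> max B C * exp (- b * t)"
      by (intro mult_right_mono) auto
    then show ?thesis by (simp add: mult.assoc flip: exp_add)
  next
    case False
    then have "f t \<le> C * exp (- b * t)" using T by simp
    also have "\<dots> \<le> max B C * exp (- b * t)" by (intro mult_right_mono) auto
    finally show ?thesis .
  qed
  then show ?thesis by blast
qed

section \<open>Solutions converging to an equilibrium\<close>

text \<open>The points with \<open>A\<^sub>2 u = (\<kappa> + i A\<^sub>2/2) z\<close> (the eigenspace for \<open>-\<kappa>\<close>, in real coordinates and with the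
  numerical values of \<open>A\<^sub>1\<close> and \<open>A\<^sub>2\<close>) on the level \<open>c\<^sup>2\<close> of a first integral. They form an ellipsoid in
  a three-dimensional space, with the equilibria \<open>(0, 0, 0, 0, \<plusminus>c)\<close> as its poles.\<close>

definition ellipsoid :: "real \<Rightarrow> real \<Rightarrow> phase set" where
  "ellipsoid \<kappa> c = {(w1, w2, w3, w4, wp).
     w2 = 2 * \<kappa> * w1 - w4 / 2 \<and> w3 = - w1 / 2 - 2 * \<kappa> * w4 \<and>
     wp\<^sup>2 + 8 / 5 * (w1\<^sup>2 + w4\<^sup>2) = c\<^sup>2}"

lemma solves_euler_iff:
  "solves euler_field (\<lambda>t. (w1 t, w2 t, w3 t, w4 t, wp t)) T \<longleftrightarrow>
   (\<forall>t\<in>T.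
     (w1 has_real_derivative - (1 / 2) * wp t * w2 t) (at t within T) \<and>
     (w2 has_real_derivative - (3 / 10) * wp t * w1 t - 1 / 2 * wp t * w3 t) (at t within T) \<and>
     (w3 has_real_derivative 1 / 2 * wp t * w2 t + 3 / 10 * wp t * w4 t) (at t within T) \<and>
     (w4 has_real_derivative 1 / 2 * wp t * w3 t) (at t within T) \<and>
     (wp has_real_derivative - (4 / 5) * (w3 t * w4 t - w1 t * w2 t)) (at t within T))"
proof -
  have pair: "((\<lambda>t. (f t, g t)) has_vector_derivative (a, b)) (at t within T) \<longleftrightarrow>
      (f has_vector_derivative a) (at t within T) \<and> (g has_vector_derivative b) (at t within T)"
    for f :: "real \<Rightarrow> 'b::real_normed_vector" and g :: "real \<Rightarrow> 'c::real_normed_vector" and a b and t :: real and T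
  proof
    assume d: "((\<lambda>t. (f t, g t)) has_vector_derivative (a, b)) (at t within T)"
    from bounded_linear.has_vector_derivative[OF bounded_linear_fst d]
      bounded_linear.has_vector_derivative[OF bounded_linear_snd d]
    show "(f has_vector_derivative a) (at t within T) \<and> (g has_vector_derivative b) (at t within T)" by simp
  next
    assume "(f has_vector_derivative a) (at t within T) \<and> (g has_vector_derivative b) (at t within T)"
    then have "(f has_derivative (\<lambda>x. x *\<^sub>R a)) (at t within T)" "(g has_derivative (\<lambda>x. x *\<^sub>R b)) (at t within T)"
      by (auto simp: has_vector_derivative_def)
    from has_derivative_Pair[OF this] show "((\<lambda>t. (f t, g t)) has_vector_derivative (a, b)) (at t within T)"
      by (simp add: has_vector_derivative_def)
  qed
  show ?thesis
    by (simp add: solves_def euler_field_def pair A1_def A2_def A12_def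
        has_real_derivative_iff_has_vector_derivative)
qed

text \<open>The sign condition \<open>\<kappa> * c > 0\<close> makes \<open>-\<kappa>\<close> the contracting and \<open>+\<kappa>\<close> the expanding direction near the
  limit, so that one argument serves both signs of \<open>c\<close>.\<close>

locale converging_solution =
  fixes w1 w2 w3 w4 wp :: "real \<Rightarrow> real" and \<kappa> c :: real
  assumes sol: "solves euler_field (\<lambda>t. (w1 t, w2 t, w3 t, w4 t, wp t)) {0..}"
    and lim: "((\<lambda>t. (w1 t, w2 t, w3 t, w4 t, wp t)) \<longlongrightarrow> equilibrium c) at_top"
    and \<kappa>_sq: "\<kappa>\<^sup>2 = 7 / 80" and \<kappa>c: "\<kappa> * c > 0"
begin

lemma limits:
  "(w1 \<longlongrightarrow> 0) at_top" "(w2 \<longlongrightarrow> 0) at_top" "(w3 \<longlongrightarrow> 0) at_top" "(w4 \<longlongrightarrow> 0) at_top"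
  "(wp \<longlongrightarrow> c) at_top"
proof -
  note l = lim[unfolded equilibrium_def]
  note s1 = tendsto_snd[OF l, simplified]
  note s2 = tendsto_snd[OF s1, simplified]
  note s3 = tendsto_snd[OF s2, simplified]
  show "(w1 \<longlongrightarrow> 0) at_top" using tendsto_fst[OF l] by simp
  show "(w2 \<longlongrightarrow> 0) at_top" using tendsto_fst[OF s1] by simp
  show "(w3 \<longlongrightarrow> 0) at_top" using tendsto_fst[OF s2] by simp
  show "(w4 \<longlongrightarrow> 0) at_top" using tendsto_fst[OF s3] by simp
  show "(wp \<longlongrightarrow> c) at_top" using tendsto_snd[OF s3] by simp
qed

lemma derivs:
  assumes "t \<ge> 0"
  shows "(w1 has_real_derivative - (1 / 2) * wp t * w2 t) (at t within {0..})"
    "(w2 has_real_derivative - (3 / 10) * wp t * w1 t - 1 / 2 * wp t * w3 t) (at t within {0..})"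
    "(w3 has_real_derivative 1 / 2 * wp t * w2 t + 3 / 10 * wp t * w4 t) (at t within {0..})"
    "(w4 has_real_derivative 1 / 2 * wp t * w3 t) (at t within {0..})"
    "(wp has_real_derivative - (4 / 5) * (w3 t * w4 t - w1 t * w2 t)) (at t within {0..})"
  using sol assms by (auto simp: solves_euler_iff)

lemma continuous:
  "continuous_on {0..} w1" "continuous_on {0..} w2" "continuous_on {0..} w3"
  "continuous_on {0..} w4" "continuous_on {0..} wp"
  by (auto simp: continuous_on_eq_continuous_within intro: DERIV_continuous derivs)

lemma \<kappa>_cancel: "\<kappa> * (\<kappa> * y) = 7 / 80 * y"
  using \<kappa>_sq by (simp add: power2_eq_square flip: mult.assoc)

text \<open>Up to a constant factor, \<open>p - i s\<close> below is the component along the eigenvector for \<open>\<kappa> - i A\<^sub>2/2\<close>. The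
  imaginary part of the eigenvalue only rotates it, which leaves \<open>2\<kappa>\<omega>\<^sub>p\<close> as the growth rate of its
  squared modulus.\<close>

lemma unstable_part_vanishes:
  assumes "t \<ge> 0"
  shows "w2 t = 2 * \<kappa> * w1 t - w4 t / 2" "w3 t = - w1 t / 2 - 2 * \<kappa> * w4 t"
proof -
  define p where "p = (\<lambda>t. w2 t - 2 * \<kappa> * w1 t + 1 / 2 * w4 t)"
  define s where "s = (\<lambda>t. w3 t + 1 / 2 * w1 t + 2 * \<kappa> * w4 t)"
  have "(p t)\<^sup>2 + (s t)\<^sup>2 = 0"
  proof (rule unstable_rate_forces_zero[where f = "\<lambda>t. (p t)\<^sup>2 + (s t)\<^sup>2"
        and g = "\<lambda>t. 2 * \<kappa> * wp t" and l = "2 * \<kappa> * c"])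
    fix t :: real assume t: "t \<ge> 0"
    have "(p has_real_derivative wp t * (\<kappa> * p t - s t / 4)) (at t within {0..})"
      unfolding p_def
      by (rule DERIV_cong, (rule derivative_intros derivs[OF t])+)
        (simp add: s_def algebra_simps add_divide_distrib diff_divide_distrib \<kappa>_cancel)
    moreover have "(s has_real_derivative wp t * (\<kappa> * s t + p t / 4)) (at t within {0..})"
      unfolding s_def
      by (rule DERIV_cong, (rule derivative_intros derivs[OF t])+)
        (simp add: p_def algebra_simps add_divide_distrib diff_divide_distrib \<kappa>_cancel)
    ultimately have "((\<lambda>t. (p t)\<^sup>2 + (s t)\<^sup>2) has_real_derivative
        2 * p t * (wp t * (\<kappa> * p t - s t / 4)) + 2 * s t * (wp t * (\<kappa> * s t + p t / 4)))
        (at t within {0..})"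
      by (auto intro!: derivative_eq_intros)
    then show "((\<lambda>t. (p t)\<^sup>2 + (s t)\<^sup>2) has_real_derivative
        2 * \<kappa> * wp t * ((p t)\<^sup>2 + (s t)\<^sup>2)) (at t within {0..})"
      by (rule DERIV_cong) (simp add: algebra_simps power2_eq_square)
  next
    show "continuous_on {0..} (\<lambda>t. 2 * \<kappa> * wp t)"
      by (intro continuous_intros continuous)
    show "((\<lambda>t. 2 * \<kappa> * wp t) \<longlongrightarrow> 2 * \<kappa> * c) at_top"
      by (intro tendsto_intros limits)
    have "((\<lambda>t. (p t)\<^sup>2 + (s t)\<^sup>2) \<longlongrightarrow>
        (0 - 2 * \<kappa> * 0 + 1 / 2 * 0)\<^sup>2 + (0 + 1 / 2 * 0 + 2 * \<kappa> * 0)\<^sup>2) at_top"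
      unfolding p_def s_def by (intro tendsto_intros limits) auto
    then show "((\<lambda>t. (p t)\<^sup>2 + (s t)\<^sup>2) \<longlongrightarrow> 0) at_top" by simp
  qed (use \<kappa>c assms in auto)
  then have "p t = 0" "s t = 0" by (auto simp: sum_power2_eq_zero_iff)
  then show "w2 t = 2 * \<kappa> * w1 t - w4 t / 2" "w3 t = - w1 t / 2 - 2 * \<kappa> * w4 t"
    by (auto simp: p_def s_def)
qed

lemma invariant:
  assumes "t \<ge> 0"
  shows "(wp t)\<^sup>2 + 8 / 5 * ((w1 t)\<^sup>2 + (w4 t)\<^sup>2) = c\<^sup>2"
proof -
  define I where "I = (\<lambda>t. (wp t)\<^sup>2 + 8 / 5 * ((w1 t)\<^sup>2 + (w4 t)\<^sup>2))"
  have "(I has_real_derivative 0) (at t within {0..})" if "t \<in> {0..}" for t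
  proof -
    have t: "t \<ge> 0" using that by simp
    show ?thesis
      unfolding I_def by (rule derivative_eq_intros derivs[OF t] refl)+ (simp add: algebra_simps)
  qed
  then obtain k where k: "\<And>t. t \<ge> 0 \<Longrightarrow> I t = k"
    using has_field_derivative_zero_constant[of "{0..}" I] by (auto simp: convex_real_interval)
  have "(I \<longlongrightarrow> c\<^sup>2 + 8 / 5 * (0\<^sup>2 + 0\<^sup>2)) at_top"
    unfolding I_def by (intro tendsto_intros limits)
  moreover have "(I \<longlongrightarrow> k) at_top"
    using k by (intro tendsto_eventually) (auto simp: eventually_at_top_linorder)
  ultimately have "k = c\<^sup>2" using tendsto_unique trivial_limit_at_top_linorder by fastforce
  with k[OF assms] show ?thesis by (simp add: I_def)
qed

lemma in_ellipsoid:
  "t \<ge> 0 \<Longrightarrow> (w1 t, w2 t, w3 t, w4 t, wp t) \<in> ellipsoid \<kappa> c"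
  using unstable_part_vanishes invariant by (auto simp: ellipsoid_def)

lemma squared_radius_deriv:
  assumes t: "t \<ge> 0"
  shows "((\<lambda>t. (w1 t)\<^sup>2 + (w4 t)\<^sup>2) has_real_derivative
    (- 2 * \<kappa> * wp t) * ((w1 t)\<^sup>2 + (w4 t)\<^sup>2)) (at t within {0..})"
  by (rule derivative_eq_intros derivs[OF t] refl)+
    (simp add: unstable_part_vanishes[OF t] field_simps power2_eq_square)

text \<open>At the opposite pole \<open>z = 0\<close>. The linear equation for \<open>|z|\<^sup>2\<close> keeps it zero forever, hence \<open>\<omega>\<^sub>p\<close> would
  be frozen at \<open>-c\<close> and could not tend to \<open>c\<close>.\<close>

lemma not_antipode:
  assumes "t \<ge> 0"
  shows "(w1 t, w2 t, w3 t, w4 t, wp t) \<noteq> equilibrium (- c)"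
proof
  assume "(w1 t, w2 t, w3 t, w4 t, wp t) = equilibrium (- c)"
  then have eq: "(w1 t)\<^sup>2 + (w4 t)\<^sup>2 = 0" "wp t = - c"
    by (auto simp: equilibrium_def)
  have zero: "(w1 s)\<^sup>2 + (w4 s)\<^sup>2 = 0" if "s \<ge> 0" for s
    by (rule linear_ode_zero_propagates[where T = t, OF squared_radius_deriv])
      (use assms eq(1) that in \<open>auto intro!: continuous_intros continuous\<close>)
  have "(wp has_real_derivative 0) (at s within {0..})" if "s \<in> {0..}" for s
    using derivs(5)[of s] zero[of s] that by (simp add: sum_power2_eq_zero_iff)
  then obtain k where k: "\<And>s. s \<ge> 0 \<Longrightarrow> wp s = k"
    using has_field_derivative_zero_constant[of "{0..}" wp] by (auto simp: convex_real_interval)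
  have "(wp \<longlongrightarrow> k) at_top"
    using k by (intro tendsto_eventually) (auto simp: eventually_at_top_linorder)
  then have "k = c"
    using limits(5) tendsto_unique trivial_limit_at_top_linorder by blast
  with k[OF assms] eq \<kappa>c show False by auto
qed

text \<open>The first integral transfers the decay of \<open>|z|\<^sup>2\<close> to \<open>\<omega>\<^sub>p\<close>: once \<open>\<omega>\<^sub>p\<close> has the sign of \<open>c\<close>,
  \<open>(\<omega>\<^sub>p - c)\<^sup>2 \<le> |\<omega>\<^sub>p\<^sup>2 - c\<^sup>2| = (8/5)|z|\<^sup>2\<close>.\<close>

lemma exponential_convergence:
  "\<exists>C a. a > 0 \<and> (\<forall>t\<ge>0. dist (w1 t, w2 t, w3 t, w4 t, wp t) (equilibrium c) \<le> C * exp (- a * t))"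
proof -
  define N where "N = (\<lambda>t. (w1 t)\<^sup>2 + (w4 t)\<^sup>2)"
  define d where "d = (\<lambda>t. dist (w1 t, w2 t, w3 t, w4 t, wp t) (equilibrium c))"
  have "((\<lambda>t. - 2 * \<kappa> * wp t) \<longlongrightarrow> - 2 * \<kappa> * c) at_top"
    by (intro tendsto_intros limits)
  then obtain C where C: "eventually (\<lambda>t. N t \<le> C * exp (- (\<kappa> * c) * t)) at_top"
    using stable_rate_exponential_decay[of N "\<lambda>t. - 2 * \<kappa> * wp t" "2 * \<kappa> * c" "\<kappa> * c"]
      squared_radius_deriv \<kappa>c unfolding N_def by auto
  have "((\<lambda>t. wp t * c) \<longlongrightarrow> c * c) at_top"
    by (intro tendsto_intros limits)
  then have same_sign: "eventually (\<lambda>t. wp t * c > 0) at_top"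
    using \<kappa>c by (intro order_tendstoD(1)[of _ "c * c"]) (auto simp: zero_less_mult_iff)
  have d_le: "d t \<le> sqrt (16 / 5) * sqrt (N t)" if t: "t \<ge> 0" and pos: "wp t * c > 0" for t
  proof -
    have "(wp t - c)\<^sup>2 \<le> \<bar>wp t - c\<bar> * \<bar>wp t + c\<bar>"
    proof -
      have "\<bar>wp t - c\<bar> \<le> \<bar>wp t + c\<bar>"
        using pos by (auto simp: zero_less_mult_iff)
      then have "\<bar>wp t - c\<bar> * \<bar>wp t - c\<bar> \<le> \<bar>wp t - c\<bar> * \<bar>wp t + c\<bar>"
        by (intro mult_left_mono) auto
      then show ?thesis by (simp add: power2_eq_square)
    qed
    also have "\<dots> = \<bar>(wp t)\<^sup>2 - c\<^sup>2\<bar>"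
      by (simp add: power2_eq_square algebra_simps flip: abs_mult)
    also have "\<dots> = 8 / 5 * N t"
    proof -
      have "(wp t)\<^sup>2 - c\<^sup>2 = - (8 / 5 * N t)" "N t \<ge> 0"
        using invariant[OF t] by (auto simp: N_def)
      then show ?thesis by linarith
    qed
    finally have wp: "(wp t - c)\<^sup>2 \<le> 8 / 5 * N t" .
    have "(w2 t)\<^sup>2 + (w3 t)\<^sup>2 = (4 * \<kappa>\<^sup>2 + 1 / 4) * N t"
      by (simp add: unstable_part_vanishes[OF t] N_def field_simps power2_eq_square)
    then have "(w1 t)\<^sup>2 + ((w2 t)\<^sup>2 + ((w3 t)\<^sup>2 + ((w4 t)\<^sup>2 + (wp t - c)\<^sup>2))) \<le> 16 / 5 * N t"
      using wp by (simp add: \<kappa>_sq N_def)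
    then have "d t \<le> sqrt (16 / 5 * N t)"
      by (simp add: d_def equilibrium_def dist_Pair_Pair dist_real_def)
    then show ?thesis by (simp only: real_sqrt_mult)
  qed
  have "eventually (\<lambda>t. d t \<le> (sqrt (16 / 5) * sqrt C) * exp (- (\<kappa> * c / 2) * t)) at_top"
    using C same_sign eventually_ge_at_top[of 0]
  proof eventually_elim
    case (elim t)
    have "sqrt (N t) \<le> sqrt (C * exp (- (\<kappa> * c) * t))"
      using elim by simp
    also have "\<dots> = sqrt C * exp (- (\<kappa> * c / 2) * t)"
    proof -
      have "exp (- (\<kappa> * c) * t) = (exp (- (\<kappa> * c / 2) * t))\<^sup>2"
        by (simp add: power2_eq_square flip: exp_add)
      then show ?thesis by (simp add: real_sqrt_mult)
    qed
    finally have "sqrt (16 / 5) * sqrt (N t) \<le> sqrt (16 / 5) * (sqrt C * exp (- (\<kappa> * c / 2) * t))"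
      by (intro mult_left_mono) auto
    with d_le[of t] elim have "d t \<le> sqrt (16 / 5) * (sqrt C * exp (- (\<kappa> * c / 2) * t))"
      by linarith
    then show ?case by (simp only: mult.assoc)
  qed
  moreover have "continuous_on {0..} d"
    unfolding d_def by (intro continuous_intros continuous)
  ultimately obtain C' where "\<forall>t\<ge>0. d t \<le> C' * exp (- (\<kappa> * c / 2) * t)"
    using eventual_exponential_bound_global by blast
  with \<kappa>c show ?thesis
    unfolding d_def by (intro exI[of _ C'] exI[of _ "\<kappa> * c / 2"]) auto
qed

end

section \<open>The explicit orbits\<close>

lemma kappa_abs_eq: "kappa_abs = sqrt (7 / 80)"
  by (simp add: kappa_abs_def A1_def A2_def flip: real_sqrt_mult)

lemma kappa_values:
  assumes "\<kappa> \<in> {kappa_abs, - kappa_abs}"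
  shows "\<kappa>\<^sup>2 = 7 / 80" "\<kappa> \<noteq> 0"
  using assms by (auto simp: kappa_abs_eq)

lemma angle_sum_trig:
  assumes "\<kappa> \<in> {kappa_abs, - kappa_abs}"
  shows "sqrt (3 / 5) * cos (angle_sum \<kappa>) = 2 * \<kappa>" "sqrt (3 / 5) * sin (angle_sum \<kappa>) = - 1 / 2"
proof -
  define x where "x = 1 / 2 * sqrt (5 / 3 :: real)"
  have x2: "x\<^sup>2 = 5 / 12" by (simp add: x_def power_divide)
  have "x \<ge> 0" by (simp add: x_def)
  moreover have "x \<le> 1" by (rule power2_le_imp_le) (simp_all add: x2)
  ultimately have sin: "sin (arcsin x) = x" and cos: "cos (arcsin x) = sqrt (7 / 12)"
    by (auto simp: cos_arcsin x2)
  have s: "sqrt (3 / 5) * x = 1 / 2" by (simp add: x_def flip: real_sqrt_mult)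
  have c: "sqrt (3 / 5) * sqrt (7 / 12) = 2 * kappa_abs"
    using real_sqrt_mult[of 4 "7 / 80"] real_sqrt_mult[of "3 / 5" "7 / 12"]
    by (simp add: kappa_abs_eq)
  have "angle_sum \<kappa> = (if \<kappa> > 0 then - arcsin x else pi + arcsin x)"
    by (simp add: angle_sum_def x_def A1_def A2_def)
  moreover have "kappa_abs > 0" by (simp add: kappa_abs_eq)
  ultimately show "sqrt (3 / 5) * cos (angle_sum \<kappa>) = 2 * \<kappa>"
      "sqrt (3 / 5) * sin (angle_sum \<kappa>) = - 1 / 2"
    using assms by (auto simp: sin cos s c sin_add cos_add)
qed

text \<open>Expanding \<open>\<vartheta> = angle_sum \<kappa> - \<theta>\<close> shows that the prescribed angle sum says exactly that the orbit lies
  in the eigenspace for \<open>-\<kappa>\<close>.\<close>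

lemma orb_eq:
  assumes "\<kappa> \<in> {kappa_abs, - kappa_abs}"
  defines "w1 \<equiv> \<lambda>\<Gamma> \<tau>0 \<theta>0 t. orb_r \<Gamma> \<kappa> \<tau>0 t * cos (orb_theta \<Gamma> \<kappa> \<tau>0 \<theta>0 t)"
    and "w4 \<equiv> \<lambda>\<Gamma> \<tau>0 \<theta>0 t. orb_r \<Gamma> \<kappa> \<tau>0 t * sin (orb_theta \<Gamma> \<kappa> \<tau>0 \<theta>0 t)"
  shows "orb \<Gamma> \<kappa> \<tau>0 \<theta>0 t =
    (w1 \<Gamma> \<tau>0 \<theta>0 t, 2 * \<kappa> * w1 \<Gamma> \<tau>0 \<theta>0 t - w4 \<Gamma> \<tau>0 \<theta>0 t / 2,
     - w1 \<Gamma> \<tau>0 \<theta>0 t / 2 - 2 * \<kappa> * w4 \<Gamma> \<tau>0 \<theta>0 t, w4 \<Gamma> \<tau>0 \<theta>0 t,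
     \<Gamma> * tanh (tau \<Gamma> \<kappa> \<tau>0 t))"
proof -
  define r \<theta> where "r = orb_r \<Gamma> \<kappa> \<tau>0 t" and "\<theta> = orb_theta \<Gamma> \<kappa> \<tau>0 \<theta>0 t"
  have "sqrt (3 / 5) * r * cos (angle_sum \<kappa> - \<theta>) =
      (sqrt (3 / 5) * cos (angle_sum \<kappa>)) * (r * cos \<theta>) + (sqrt (3 / 5) * sin (angle_sum \<kappa>)) * (r * sin \<theta>)"
    by (simp add: cos_diff algebra_simps)
  then have c: "sqrt (3 / 5) * r * cos (angle_sum \<kappa> - \<theta>) = 2 * \<kappa> * (r * cos \<theta>) - (r * sin \<theta>) / 2"
    by (simp add: angle_sum_trig[OF assms(1)])
  have "sqrt (3 / 5) * r * sin (angle_sum \<kappa> - \<theta>) =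
      (sqrt (3 / 5) * sin (angle_sum \<kappa>)) * (r * cos \<theta>) - (sqrt (3 / 5) * cos (angle_sum \<kappa>)) * (r * sin \<theta>)"
    by (simp add: sin_diff algebra_simps)
  then have s: "sqrt (3 / 5) * r * sin (angle_sum \<kappa> - \<theta>) = - (r * cos \<theta>) / 2 - 2 * \<kappa> * (r * sin \<theta>)"
    by (simp add: angle_sum_trig[OF assms(1)])
  have ratio: "sqrt (- A1 / A2) = sqrt (3 / 5)" by (simp add: A1_def A2_def)
  show ?thesis
    using c s unfolding orb_def orb_rho_def orb_vartheta_def w1_def w4_def ratio r_def \<theta>_def by simp
qed

lemma sech_sq: "(sech x)\<^sup>2 = 1 - (tanh x)\<^sup>2"
proof -
  have "1 - (sinh x)\<^sup>2 / (cosh x)\<^sup>2 = ((cosh x)\<^sup>2 - (sinh x)\<^sup>2) / (cosh x)\<^sup>2"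
    by (simp add: diff_divide_distrib)
  then show ?thesis
    by (simp add: sech_def tanh_def power_divide hyperbolic_pythagoras)
qed

lemma sech_nonzero: "sech x \<noteq> 0"
  by (simp add: sech_def)

lemma sech_limits: "(sech \<longlongrightarrow> 0) at_top" "(sech \<longlongrightarrow> 0) at_bot"
proof -
  have eq: "sech = (\<lambda>x. inverse (cosh x))" by (simp add: sech_def fun_eq_iff field_simps)
  show "(sech \<longlongrightarrow> 0) at_top"
    unfolding eq by (intro tendsto_inverse_0_at_top cosh_real_at_top)
  show "(sech \<longlongrightarrow> 0) at_bot"
    unfolding eq by (intro tendsto_inverse_0_at_top cosh_real_at_bot)
qed

lemma orb_r_sq: "(orb_r \<Gamma> \<kappa> \<tau>0 t)\<^sup>2 = 5 / 8 * \<Gamma>\<^sup>2 * (1 - (tanh (tau \<Gamma> \<kappa> \<tau>0 t))\<^sup>2)"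
  by (simp add: orb_r_def A1_def A2_def power_mult_distrib sech_sq)

lemma orb_in_ellipsoid:
  assumes "\<kappa> \<in> {kappa_abs, - kappa_abs}"
  shows "orb \<Gamma> \<kappa> \<tau>0 \<theta>0 t \<in> ellipsoid \<kappa> \<Gamma>"
proof -
  have norm: "(orb_r \<Gamma> \<kappa> \<tau>0 t * cos \<theta>)\<^sup>2 + (orb_r \<Gamma> \<kappa> \<tau>0 t * sin \<theta>)\<^sup>2 = (orb_r \<Gamma> \<kappa> \<tau>0 t)\<^sup>2" for \<theta>
    by (simp add: power_mult_distrib flip: distrib_left)
  have "(\<Gamma> * tanh (tau \<Gamma> \<kappa> \<tau>0 t))\<^sup>2 + 8 / 5 * ((orb_r \<Gamma> \<kappa> \<tau>0 t * cos \<theta>)\<^sup>2 +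
      (orb_r \<Gamma> \<kappa> \<tau>0 t * sin \<theta>)\<^sup>2) = \<Gamma>\<^sup>2" for \<theta>
    by (subst norm, subst orb_r_sq) (simp add: power_mult_distrib field_simps)
  then show ?thesis
    unfolding orb_eq[OF assms] ellipsoid_def mem_Collect_eq prod.case by blast
qed

lemma orb_not_equilibrium:
  assumes "\<Gamma> \<noteq> 0" "\<kappa> \<in> {kappa_abs, - kappa_abs}"
  shows "orb \<Gamma> \<kappa> \<tau>0 \<theta>0 t \<noteq> equilibrium c"
proof
  assume "orb \<Gamma> \<kappa> \<tau>0 \<theta>0 t = equilibrium c"
  moreover have "orb_r \<Gamma> \<kappa> \<tau>0 t \<noteq> 0"
    using assms(1) by (simp add: orb_r_def A1_def A2_def sech_nonzero)
  ultimately have "cos (orb_theta \<Gamma> \<kappa> \<tau>0 \<theta>0 t) = 0" "sin (orb_theta \<Gamma> \<kappa> \<tau>0 \<theta>0 t) = 0"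
    by (auto simp: orb_def equilibrium_def)
  then show False using sin_zero_abs_cos_one by fastforce
qed

lemma tau_deriv: "(tau \<Gamma> \<kappa> \<tau>0 has_real_derivative \<kappa> * \<Gamma>) (at t)"
  unfolding tau_def[abs_def] by (auto intro!: derivative_eq_intros)

lemma sech_tau_deriv:
  "((\<lambda>t. sech (tau \<Gamma> \<kappa> \<tau>0 t)) has_real_derivative
    - \<kappa> * (\<Gamma> * tanh (tau \<Gamma> \<kappa> \<tau>0 t)) * sech (tau \<Gamma> \<kappa> \<tau>0 t)) (at t)"
  unfolding sech_def
  by (rule derivative_eq_intros tau_deriv refl | simp add: tanh_def field_simps power2_eq_square)+

lemma log_cosh_tau_deriv:
  "((\<lambda>t. ln (cosh (tau \<Gamma> \<kappa> \<tau>0 t))) has_real_derivative \<kappa> * (\<Gamma> * tanh (tau \<Gamma> \<kappa> \<tau>0 t))) (at t)"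
  by (rule derivative_eq_intros tau_deriv refl | simp add: tanh_def field_simps)+

lemma orb_theta_deriv:
  assumes "\<kappa> \<noteq> 0"
  shows "(orb_theta \<Gamma> \<kappa> \<tau>0 \<theta>0 has_real_derivative - (1 / 4) * (\<Gamma> * tanh (tau \<Gamma> \<kappa> \<tau>0 t))) (at t)"
  unfolding orb_theta_def[abs_def]
  by (rule DERIV_cong, (rule log_cosh_tau_deriv derivative_intros)+)
    (use assms in \<open>simp add: A2_def\<close>)

lemma orb_r_deriv:
  "(orb_r \<Gamma> \<kappa> \<tau>0 has_real_derivative
    - \<kappa> * (\<Gamma> * tanh (tau \<Gamma> \<kappa> \<tau>0 t)) * orb_r \<Gamma> \<kappa> \<tau>0 t) (at t)"
  unfolding orb_r_def[abs_def]
  by (auto intro!: derivative_eq_intros sech_tau_deriv)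

lemma orb_solves:
  assumes \<kappa>: "\<kappa> \<in> {kappa_abs, - kappa_abs}"
  shows "solves euler_field (orb \<Gamma> \<kappa> \<tau>0 \<theta>0) T"
proof -
  define w1 w4 wp where
    "w1 = (\<lambda>t. orb_r \<Gamma> \<kappa> \<tau>0 t * cos (orb_theta \<Gamma> \<kappa> \<tau>0 \<theta>0 t))" and
    "w4 = (\<lambda>t. orb_r \<Gamma> \<kappa> \<tau>0 t * sin (orb_theta \<Gamma> \<kappa> \<tau>0 \<theta>0 t))" and
    "wp = (\<lambda>t. \<Gamma> * tanh (tau \<Gamma> \<kappa> \<tau>0 t))"
  note \<kappa>_sq = kappa_values(1)[OF \<kappa>] and \<kappa>0 = kappa_values(2)[OF \<kappa>]
  have \<kappa>_cancel: "\<kappa> * (\<kappa> * y) = 7 / 80 * y" for y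
    using \<kappa>_sq by (simp add: power2_eq_square flip: mult.assoc)
  have orb: "orb \<Gamma> \<kappa> \<tau>0 \<theta>0 = (\<lambda>t. (w1 t, 2 * \<kappa> * w1 t - 1 / 2 * w4 t, - (1 / 2) * w1 t - 2 * \<kappa> * w4 t, w4 t, wp t))"
    by (simp add: orb_eq[OF \<kappa>] w1_def w4_def wp_def fun_eq_iff)
  have d1: "(w1 has_real_derivative wp t * (- \<kappa> * w1 t + 1 / 4 * w4 t)) (at t within T)" for t
    unfolding w1_def
    by (rule derivative_eq_intros orb_theta_deriv[OF \<kappa>0, THEN DERIV_subset] orb_r_deriv[THEN DERIV_subset] subset_UNIV refl)+
      (simp add: w4_def wp_def algebra_simps)
  have d4: "(w4 has_real_derivative wp t * (- \<kappa> * w4 t - 1 / 4 * w1 t)) (at t within T)" for t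
    unfolding w4_def
    by (rule derivative_eq_intros orb_theta_deriv[OF \<kappa>0, THEN DERIV_subset] orb_r_deriv[THEN DERIV_subset] subset_UNIV refl)+
      (simp add: w1_def wp_def algebra_simps)
  have inv: "(wp t)\<^sup>2 + 8 / 5 * ((w1 t)\<^sup>2 + (w4 t)\<^sup>2) = \<Gamma>\<^sup>2" for t
    using orb_in_ellipsoid[OF \<kappa>, of \<Gamma> \<tau>0 \<theta>0 t] by (simp add: orb ellipsoid_def)
  have dp: "(wp has_real_derivative 8 / 5 * \<kappa> * ((w1 t)\<^sup>2 + (w4 t)\<^sup>2)) (at t within T)" for t
  proof -
    have "((\<lambda>t. \<Gamma> * tanh (tau \<Gamma> \<kappa> \<tau>0 t)) has_real_derivative \<Gamma> * ((1 - (tanh (tau \<Gamma> \<kappa> \<tau>0 t))\<^sup>2) * (\<kappa> * \<Gamma>))) (at t)"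
      by (rule derivative_eq_intros tau_deriv refl | simp)+
    moreover have "\<Gamma> * ((1 - (tanh (tau \<Gamma> \<kappa> \<tau>0 t))\<^sup>2) * (\<kappa> * \<Gamma>)) = \<kappa> * (\<Gamma>\<^sup>2 - (wp t)\<^sup>2)"
      by (simp add: wp_def algebra_simps power2_eq_square)
    moreover have "\<dots> = 8 / 5 * \<kappa> * ((w1 t)\<^sup>2 + (w4 t)\<^sup>2)"
      by (subst inv[symmetric, of t]) simp
    ultimately show ?thesis unfolding wp_def by (metis DERIV_subset subset_UNIV)
  qed
  show ?thesis
    unfolding orb solves_euler_iff
  proof (intro ballI conjI)
    fix t
    show "(w1 has_real_derivative - (1 / 2) * wp t * (2 * \<kappa> * w1 t - 1 / 2 * w4 t)) (at t within T)"
      by (rule DERIV_cong[OF d1]) (simp add: algebra_simps)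
    show "(w4 has_real_derivative 1 / 2 * wp t * (- (1 / 2) * w1 t - 2 * \<kappa> * w4 t)) (at t within T)"
      by (rule DERIV_cong[OF d4]) (simp add: algebra_simps)
    show "(wp has_real_derivative - (4 / 5) * ((- (1 / 2) * w1 t - 2 * \<kappa> * w4 t) * w4 t - w1 t * (2 * \<kappa> * w1 t - 1 / 2 * w4 t))) (at t within T)"
      by (rule DERIV_cong[OF dp]) (simp add: algebra_simps power2_eq_square)
    show "((\<lambda>t. 2 * \<kappa> * w1 t - 1 / 2 * w4 t) has_real_derivative
        - (3 / 10) * wp t * w1 t - 1 / 2 * wp t * (- (1 / 2) * w1 t - 2 * \<kappa> * w4 t)) (at t within T)"
      by (rule DERIV_cong, (rule derivative_intros d1 d4)+)
        (simp add: algebra_simps add_divide_distrib diff_divide_distrib \<kappa>_cancel)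
    show "((\<lambda>t. - (1 / 2) * w1 t - 2 * \<kappa> * w4 t) has_real_derivative
        1 / 2 * wp t * (2 * \<kappa> * w1 t - 1 / 2 * w4 t) + 3 / 10 * wp t * w4 t) (at t within T)"
      by (rule DERIV_cong, (rule derivative_intros d1 d4)+)
        (simp add: algebra_simps add_divide_distrib diff_divide_distrib \<kappa>_cancel)
  qed
qed

lemma bounded_mult_tendsto_zero:
  fixes f g :: "'a \<Rightarrow> real"
  assumes "(f \<longlongrightarrow> 0) F" "\<And>x. \<bar>g x\<bar> \<le> B"
  shows "((\<lambda>x. f x * g x) \<longlongrightarrow> 0) F"
proof (rule Lim_null_comparison)
  have "norm (f x * g x) \<le> \<bar>f x\<bar> * B" for x
    using assms(2)[of x] by (simp add: abs_mult mult_left_mono)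
  then show "eventually (\<lambda>x. norm (f x * g x) \<le> \<bar>f x\<bar> * B) F" by simp
  show "((\<lambda>x. \<bar>f x\<bar> * B) \<longlongrightarrow> 0) F"
    using tendsto_mult_right[OF tendsto_rabs_zero[OF assms(1)], of B] by simp
qed

lemma tau_limits:
  "\<kappa> * \<Gamma> > 0 \<Longrightarrow> filterlim (tau \<Gamma> \<kappa> \<tau>0) at_top at_top"
  "\<kappa> * \<Gamma> > 0 \<Longrightarrow> filterlim (tau \<Gamma> \<kappa> \<tau>0) at_bot at_bot"
  "\<kappa> * \<Gamma> < 0 \<Longrightarrow> filterlim (tau \<Gamma> \<kappa> \<tau>0) at_bot at_top"
  "\<kappa> * \<Gamma> < 0 \<Longrightarrow> filterlim (tau \<Gamma> \<kappa> \<tau>0) at_top at_bot"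
proof -
  have top: "filterlim (\<lambda>t. b + a * t) at_top at_top" if "a > 0" for a b :: real
    using filterlim_tendsto_add_at_top[OF tendsto_const
        filterlim_tendsto_pos_mult_at_top[OF tendsto_const that filterlim_ident]] .
  have bot: "filterlim (\<lambda>t. \<tau>0 + a * t) at_bot at_bot" if "a > 0" for a :: real
    using top[OF that, of "- \<tau>0"] by (simp add: filterlim_at_bot_mirror filterlim_uminus_at_bot)
  have tau: "tau \<Gamma> \<kappa> \<tau>0 = (\<lambda>t. \<tau>0 + (\<kappa> * \<Gamma>) * t)"
    "tau \<Gamma> \<kappa> \<tau>0 = (\<lambda>t. \<tau>0 + (- (\<kappa> * \<Gamma>)) * (- t))"
    by (simp_all add: tau_def fun_eq_iff)
  show "\<kappa> * \<Gamma> > 0 \<Longrightarrow> filterlim (tau \<Gamma> \<kappa> \<tau>0) at_top at_top"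
    unfolding tau(1) by (rule top)
  show "\<kappa> * \<Gamma> > 0 \<Longrightarrow> filterlim (tau \<Gamma> \<kappa> \<tau>0) at_bot at_bot"
    unfolding tau(1) by (rule bot)
  show "\<kappa> * \<Gamma> < 0 \<Longrightarrow> filterlim (tau \<Gamma> \<kappa> \<tau>0) at_bot at_top"
    unfolding tau(2) by (rule filterlim_compose[OF bot filterlim_uminus_at_bot_at_top]) simp
  show "\<kappa> * \<Gamma> < 0 \<Longrightarrow> filterlim (tau \<Gamma> \<kappa> \<tau>0) at_top at_bot"
    unfolding tau(2) by (rule filterlim_compose[OF top filterlim_uminus_at_top_at_bot]) simp
qed

lemma orb_tendsto:
  assumes \<kappa>: "\<kappa> \<in> {kappa_abs, - kappa_abs}"
    and sech: "((\<lambda>t. sech (tau \<Gamma> \<kappa> \<tau>0 t)) \<longlongrightarrow> 0) F"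
    and tanh: "((\<lambda>t. tanh (tau \<Gamma> \<kappa> \<tau>0 t)) \<longlongrightarrow> s) F"
  shows "(orb \<Gamma> \<kappa> \<tau>0 \<theta>0 \<longlongrightarrow> equilibrium (\<Gamma> * s)) F"
proof -
  have r: "(orb_r \<Gamma> \<kappa> \<tau>0 \<longlongrightarrow> 0) F"
    unfolding orb_r_def[abs_def] using tendsto_mult_left[OF sech] by simp
  have \<rho>: "(orb_rho \<Gamma> \<kappa> \<tau>0 \<longlongrightarrow> 0) F"
    unfolding orb_rho_def[abs_def] using tendsto_mult_left[OF r] by simp
  show ?thesis
    unfolding orb_def[abs_def] equilibrium_def
    by (intro tendsto_Pair bounded_mult_tendsto_zero[where B = 1] r \<rho> tendsto_mult_left tanh) auto
qed

lemma orb_limits: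
  assumes \<kappa>: "\<kappa> \<in> {kappa_abs, - kappa_abs}"
  shows "\<kappa> * \<Gamma> > 0 \<Longrightarrow> (orb \<Gamma> \<kappa> \<tau>0 \<theta>0 \<longlongrightarrow> equilibrium \<Gamma>) at_top"
    and "\<kappa> * \<Gamma> > 0 \<Longrightarrow> (orb \<Gamma> \<kappa> \<tau>0 \<theta>0 \<longlongrightarrow> equilibrium (- \<Gamma>)) at_bot"
    and "\<kappa> * \<Gamma> < 0 \<Longrightarrow> (orb \<Gamma> \<kappa> \<tau>0 \<theta>0 \<longlongrightarrow> equilibrium (- \<Gamma>)) at_top"
    and "\<kappa> * \<Gamma> < 0 \<Longrightarrow> (orb \<Gamma> \<kappa> \<tau>0 \<theta>0 \<longlongrightarrow> equilibrium \<Gamma>) at_bot"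
proof -
  note lims = filterlim_compose[OF sech_limits(1)] filterlim_compose[OF sech_limits(2)]
    filterlim_compose[OF tanh_real_at_top] filterlim_compose[OF tanh_real_at_bot]
  show "(orb \<Gamma> \<kappa> \<tau>0 \<theta>0 \<longlongrightarrow> equilibrium \<Gamma>) at_top" if "\<kappa> * \<Gamma> > 0"
    using orb_tendsto[OF \<kappa> lims(1,3)[OF tau_limits(1)[OF that]]] by simp
  show "(orb \<Gamma> \<kappa> \<tau>0 \<theta>0 \<longlongrightarrow> equilibrium (- \<Gamma>)) at_bot" if "\<kappa> * \<Gamma> > 0"
    using orb_tendsto[OF \<kappa> lims(2,4)[OF tau_limits(2)[OF that]]] by simp
  show "(orb \<Gamma> \<kappa> \<tau>0 \<theta>0 \<longlongrightarrow> equilibrium (- \<Gamma>)) at_top" if "\<kappa> * \<Gamma> < 0"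
    using orb_tendsto[OF \<kappa> lims(2,4)[OF tau_limits(3)[OF that]]] by simp
  show "(orb \<Gamma> \<kappa> \<tau>0 \<theta>0 \<longlongrightarrow> equilibrium \<Gamma>) at_bot" if "\<kappa> * \<Gamma> < 0"
    using orb_tendsto[OF \<kappa> lims(1,3)[OF tau_limits(4)[OF that]]] by simp
qed

text \<open>Surjectivity: \<open>\<omega>\<^sub>p\<close> determines \<open>\<tau>\<close> through \<open>tanh\<close>, the first integral then gives \<open>r\<^sup>2 = |z|\<^sup>2\<close>, and \<open>\<theta>\<close> is
  the argument of \<open>z / r\<close>; it suffices to pass through each point at time \<open>0\<close>.\<close>

lemma orbit_family_eq:
  assumes \<Gamma>: "\<Gamma> \<noteq> 0" and \<kappa>: "\<kappa> \<in> {kappa_abs, - kappa_abs}"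
  shows "orbit_family \<Gamma> \<kappa> = ellipsoid \<kappa> \<Gamma> - {equilibrium \<Gamma>, equilibrium (- \<Gamma>)}"
proof (intro equalityI subsetI)
  fix p assume "p \<in> orbit_family \<Gamma> \<kappa>"
  then show "p \<in> ellipsoid \<kappa> \<Gamma> - {equilibrium \<Gamma>, equilibrium (- \<Gamma>)}"
    using orb_in_ellipsoid[OF \<kappa>] orb_not_equilibrium[OF \<Gamma> \<kappa>] by (auto simp: orbit_family_def)
next
  fix p assume p: "p \<in> ellipsoid \<kappa> \<Gamma> - {equilibrium \<Gamma>, equilibrium (- \<Gamma>)}"
  obtain w1 w2 w3 w4 wp where p_eq: "p = (w1, w2, w3, w4, wp)" by (cases p) auto
  have w23: "w2 = 2 * \<kappa> * w1 - w4 / 2" "w3 = - w1 / 2 - 2 * \<kappa> * w4"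
    and inv: "wp\<^sup>2 + 8 / 5 * (w1\<^sup>2 + w4\<^sup>2) = \<Gamma>\<^sup>2"
    using p by (auto simp: p_eq ellipsoid_def)
  have pos: "w1\<^sup>2 + w4\<^sup>2 > 0"
  proof (rule ccontr)
    assume "\<not> w1\<^sup>2 + w4\<^sup>2 > 0"
    then have "w1 = 0" "w4 = 0" by (auto simp: sum_power2_gt_zero_iff)
    moreover from this have "wp = \<Gamma> \<or> wp = - \<Gamma>" using inv by (simp add: power2_eq_iff)
    ultimately show False using p by (auto simp: p_eq w23 equilibrium_def)
  qed
  define x where "x = wp / \<Gamma>"
  have x_sq: "1 - x\<^sup>2 = 8 / 5 * (w1\<^sup>2 + w4\<^sup>2) / \<Gamma>\<^sup>2"
  proof -
    have "1 - x\<^sup>2 = (\<Gamma>\<^sup>2 - wp\<^sup>2) / \<Gamma>\<^sup>2"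
      using \<Gamma> by (simp add: x_def power_divide diff_divide_distrib)
    moreover have "8 / 5 * (w1\<^sup>2 + w4\<^sup>2) = \<Gamma>\<^sup>2 - wp\<^sup>2" using inv by linarith
    ultimately show ?thesis by presburger
  qed
  moreover have "8 / 5 * (w1\<^sup>2 + w4\<^sup>2) / \<Gamma>\<^sup>2 > 0" using pos \<Gamma> by simp
  ultimately have "x\<^sup>2 < 1" by linarith
  then have x: "- 1 < x" "x < 1" by (auto simp: abs_square_less_1)
  have "tanh (artanh x) = x"
    using x by (simp add: artanh_def tanh_real_altdef exp_minus field_simps flip: ln_inverse)
  then obtain \<tau>0 where \<tau>0: "tanh \<tau>0 = x" by blast
  define r where "r = orb_r \<Gamma> \<kappa> \<tau>0 0"
  have r_sq: "r\<^sup>2 = w1\<^sup>2 + w4\<^sup>2"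
    using \<Gamma> by (simp add: r_def orb_r_sq tau_def \<tau>0 x_sq field_simps)
  then have r0: "r \<noteq> 0" using pos by auto
  have "(w1 / r)\<^sup>2 + (w4 / r)\<^sup>2 = 1"
    using r0 by (simp add: power_divide r_sq flip: add_divide_distrib) (use pos in auto)
  then obtain \<theta> where \<theta>: "w1 / r = cos \<theta>" "w4 / r = sin \<theta>"
    using sincos_total_2pi by metis
  define \<theta>0 where "\<theta>0 = \<theta> - (- A2 / (2 * \<kappa>) * ln (cosh \<tau>0))"
  have "orb_theta \<Gamma> \<kappa> \<tau>0 \<theta>0 0 = \<theta>" by (simp add: orb_theta_def \<theta>0_def tau_def)
  moreover have "r * cos \<theta> = w1" "r * sin \<theta> = w4"
    using r0 by (auto simp flip: \<theta>)
  moreover have "\<Gamma> * tanh (tau \<Gamma> \<kappa> \<tau>0 0) = wp" using \<Gamma> by (simp add: tau_def \<tau>0 x_def)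
  ultimately have "orb \<Gamma> \<kappa> \<tau>0 \<theta>0 0 = p"
    by (simp add: orb_eq[OF \<kappa>] p_eq w23 r_def)
  then show "p \<in> orbit_family \<Gamma> \<kappa>" by (auto simp: orbit_family_def intro: range_eqI)
qed

section \<open>The auxiliary modes\<close>

lemma
  assumes \<Gamma>: "\<Gamma> \<noteq> 0" and \<kappa>: "\<kappa> \<in> {kappa_abs, - kappa_abs}"
  shows omega0_deriv: "(omega0 \<Gamma> \<kappa> \<tau>0 \<theta>0 has_real_derivative aux_field0 (orb \<Gamma> \<kappa> \<tau>0 \<theta>0 t)) (at t)"
    and omega5_deriv: "(omega5 \<Gamma> \<kappa> \<tau>0 \<theta>0 has_real_derivative aux_field5 (orb \<Gamma> \<kappa> \<tau>0 \<theta>0 t)) (at t)"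
proof -
  note \<kappa>0 = kappa_values(2)[OF \<kappa>]
  define \<beta> where "\<beta> = aux_beta \<kappa>"
  define K where "K = aux_alpha \<Gamma> \<kappa> * \<beta> / (1 + \<beta>\<^sup>2)"
  define S L wp where "S = (\<lambda>t. sech (tau \<Gamma> \<kappa> \<tau>0 t))"
    and "L = (\<lambda>t. \<beta> * ln (cosh (tau \<Gamma> \<kappa> \<tau>0 t)) + \<theta>0)"
    and "wp = (\<lambda>t. \<Gamma> * tanh (tau \<Gamma> \<kappa> \<tau>0 t))"
  have \<beta>0: "\<beta> \<noteq> 0" using \<kappa>0 by (simp add: \<beta>_def aux_beta_def A2_def)
  have dS: "(S has_real_derivative - \<kappa> * wp t * S t) (at t)"
    unfolding S_def wp_def by (rule sech_tau_deriv)
  have dL: "(L has_real_derivative \<beta> * (\<kappa> * wp t)) (at t)"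
    unfolding L_def wp_def
    by (rule DERIV_cong, (rule log_cosh_tau_deriv derivative_intros)+) simp
  have L: "orb_theta \<Gamma> \<kappa> \<tau>0 \<theta>0 t = L t" for t
    by (simp add: orb_theta_def L_def \<beta>_def aux_beta_def)
  \<comment> \<open>Differentiating \<open>S * sin L\<close> and \<open>S * cos L\<close> mixes the two with weights \<open>1\<close> and \<open>\<beta>\<close>; in the given
    combination one trigonometric term cancels and the other is left with the factor \<open>1 / \<beta> + \<beta>\<close>,
    which the amplitude \<open>K\<close> is chosen to undo.\<close>
  have "1 + \<beta>\<^sup>2 \<noteq> 0" using zero_le_power2[of \<beta>] by linarith
  then have "K * (1 / \<beta> + \<beta>) = aux_alpha \<Gamma> \<kappa>"
    using \<beta>0 by (simp add: K_def divide_simps) (simp add: power2_eq_square algebra_simps)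
  then have "\<kappa> * (K * (1 / \<beta> + \<beta>)) = - A1 * sqrt (A2 / (A2 - A1)) * \<Gamma>"
    using \<kappa>0 by (simp add: aux_alpha_def)
  then have r: "- A1 * orb_r \<Gamma> \<kappa> \<tau>0 t = \<kappa> * (K * (1 / \<beta> + \<beta>)) * S t"
    by (simp add: orb_r_def S_def)
  have "omega0 \<Gamma> \<kappa> \<tau>0 \<theta>0 = (\<lambda>t. K * S t * (sin (L t) - 1 / \<beta> * cos (L t)))"
    by (simp add: omega0_def Let_def K_def S_def L_def \<beta>_def fun_eq_iff)
  moreover have "((\<lambda>t. K * S t * (sin (L t) - 1 / \<beta> * cos (L t))) has_real_derivative
      wp t * (\<kappa> * (K * (1 / \<beta> + \<beta>)) * S t) * cos (L t)) (at t)"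
    by (rule derivative_eq_intros dS dL refl)+ (use \<beta>0 in \<open>simp add: field_simps\<close>)
  ultimately show "(omega0 \<Gamma> \<kappa> \<tau>0 \<theta>0 has_real_derivative aux_field0 (orb \<Gamma> \<kappa> \<tau>0 \<theta>0 t)) (at t)"
    by (simp add: aux_field0_def orb_def L wp_def flip: r) (simp add: algebra_simps)
  have "omega5 \<Gamma> \<kappa> \<tau>0 \<theta>0 = (\<lambda>t. K * S t * (cos (L t) + 1 / \<beta> * sin (L t)))"
    by (simp add: omega5_def Let_def K_def S_def L_def \<beta>_def fun_eq_iff)
  moreover have "((\<lambda>t. K * S t * (cos (L t) + 1 / \<beta> * sin (L t))) has_real_derivative
      - wp t * (\<kappa> * (K * (1 / \<beta> + \<beta>)) * S t) * sin (L t)) (at t)"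
    by (rule derivative_eq_intros dS dL refl)+ (use \<beta>0 in \<open>simp add: field_simps\<close>)
  ultimately show "(omega5 \<Gamma> \<kappa> \<tau>0 \<theta>0 has_real_derivative aux_field5 (orb \<Gamma> \<kappa> \<tau>0 \<theta>0 t)) (at t)"
    by (simp add: aux_field5_def orb_def L wp_def flip: r) (simp add: algebra_simps)
qed

lemma sech_tau_limits:
  assumes "\<kappa> * \<Gamma> \<noteq> 0"
  shows "((\<lambda>t. sech (tau \<Gamma> \<kappa> \<tau>0 t)) \<longlongrightarrow> 0) at_top" "((\<lambda>t. sech (tau \<Gamma> \<kappa> \<tau>0 t)) \<longlongrightarrow> 0) at_bot"
proof -
  consider "\<kappa> * \<Gamma> > 0" | "\<kappa> * \<Gamma> < 0" using assms by linarith
  then show "((\<lambda>t. sech (tau \<Gamma> \<kappa> \<tau>0 t)) \<longlongrightarrow> 0) at_top" "((\<lambda>t. sech (tau \<Gamma> \<kappa> \<tau>0 t)) \<longlongrightarrow> 0) at_bot"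
    by (cases; blast intro: filterlim_compose sech_limits tau_limits)+
qed

lemma omega_tendsto_zero:
  assumes "((\<lambda>t. sech (tau \<Gamma> \<kappa> \<tau>0 t)) \<longlongrightarrow> 0) F"
  shows "(omega0 \<Gamma> \<kappa> \<tau>0 \<theta>0 \<longlongrightarrow> 0) F" "(omega5 \<Gamma> \<kappa> \<tau>0 \<theta>0 \<longlongrightarrow> 0) F"
proof -
  have bound: "\<bar>a * cos y\<bar> \<le> \<bar>a\<bar>" "\<bar>a * sin y\<bar> \<le> \<bar>a\<bar>" for a y :: real
    by (auto simp: abs_mult intro!: mult_left_le)
  have "((\<lambda>t. (K * sech (tau \<Gamma> \<kappa> \<tau>0 t)) * (sin (y t) - a * cos (y t))) \<longlongrightarrow> 0) F" for K a :: real and y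
  proof (rule bounded_mult_tendsto_zero[where B = "1 + \<bar>a\<bar>"])
    show "((\<lambda>t. K * sech (tau \<Gamma> \<kappa> \<tau>0 t)) \<longlongrightarrow> 0) F"
      using tendsto_mult_left[OF assms, of K] by simp
    show "\<bar>sin (y t) - a * cos (y t)\<bar> \<le> 1 + \<bar>a\<bar>" for t
      using abs_sin_le_one[of "y t"] bound(1)[of a "y t"] by linarith
  qed
  then show "(omega0 \<Gamma> \<kappa> \<tau>0 \<theta>0 \<longlongrightarrow> 0) F"
    by (simp only: omega0_def[abs_def] Let_def)
  have "((\<lambda>t. (K * sech (tau \<Gamma> \<kappa> \<tau>0 t)) * (cos (y t) + a * sin (y t))) \<longlongrightarrow> 0) F" for K a :: real and y
  proof (rule bounded_mult_tendsto_zero[where B = "1 + \<bar>a\<bar>"])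
    show "((\<lambda>t. K * sech (tau \<Gamma> \<kappa> \<tau>0 t)) \<longlongrightarrow> 0) F"
      using tendsto_mult_left[OF assms, of K] by simp
    show "\<bar>cos (y t) + a * sin (y t)\<bar> \<le> 1 + \<bar>a\<bar>" for t
      using abs_cos_le_one[of "y t"] bound(2)[of a "y t"] by linarith
  qed
  then show "(omega5 \<Gamma> \<kappa> \<tau>0 \<theta>0 \<longlongrightarrow> 0) F"
    by (simp only: omega5_def[abs_def] Let_def)
qed

text \<open>Two antiderivatives differ by a constant, which the common limit forces to be \<open>0\<close>.\<close>

lemma vanishing_antiderivative_unique:
  fixes v w f :: "real \<Rightarrow> real"
  assumes v: "\<And>t. (v has_real_derivative f t) (at t)" "(v \<longlongrightarrow> 0) at_top" "(v \<longlongrightarrow> 0) at_bot"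
  shows "(\<forall>t. (w has_real_derivative f t) (at t)) \<and> (w \<longlongrightarrow> 0) at_top \<and> (w \<longlongrightarrow> 0) at_bot
    \<longleftrightarrow> (\<forall>t. w t = v t)"
proof
  assume w: "(\<forall>t. (w has_real_derivative f t) (at t)) \<and> (w \<longlongrightarrow> 0) at_top \<and> (w \<longlongrightarrow> 0) at_bot"
  have d: "((\<lambda>t. w t - v t) has_real_derivative 0) (at t within UNIV)" for t
    using DERIV_diff[of w "f t" t UNIV v "f t"] w v(1) by simp
  have "\<exists>k. \<forall>t\<in>UNIV. w t - v t = k"
    by (rule has_field_derivative_zero_constant[OF _ d]) simp
  then obtain k where k: "\<And>t. w t - v t = k" by blast
  have "((\<lambda>t. w t - v t) \<longlongrightarrow> 0 - 0) at_top"
    using w v(2) by (intro tendsto_diff) auto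
  then have "k = 0" by (simp add: k tendsto_const_iff)
  with k show "\<forall>t. w t = v t" by simp
next
  assume "\<forall>t. w t = v t"
  then have "w = v" by blast
  with v show "(\<forall>t. (w has_real_derivative f t) (at t)) \<and> (w \<longlongrightarrow> 0) at_top \<and> (w \<longlongrightarrow> 0) at_bot"
    by blast
qed

section \<open>Stable and unstable manifolds\<close>

lemma equilibrium_minus: "- equilibrium c = equilibrium (- c)"
  by (simp add: equilibrium_def)

lemma equilibrium_in_line: "equilibrium c \<in> fixed_line"
  by (simp add: equilibrium_def fixed_line_def)

lemma fixed_line_stationary: "q \<in> fixed_line \<Longrightarrow> euler_field q = 0"
  by (auto simp: fixed_line_def euler_field_def zero_prod_def)

lemma constant_solves: "solves euler_field (\<lambda>t. equilibrium c) T"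
  by (simp add: solves_def fixed_line_stationary[OF equilibrium_in_line])

lemma converging_solution_components:
  assumes "solves euler_field x {0..}" "(x \<longlongrightarrow> equilibrium c) at_top"
    "\<kappa> \<in> {kappa_abs, - kappa_abs}" "\<kappa> * c > 0"
  obtains w1 w2 w3 w4 wp where
    "x = (\<lambda>t. (w1 t, w2 t, w3 t, w4 t, wp t))" "converging_solution w1 w2 w3 w4 wp \<kappa> c"
proof -
  have x: "x = (\<lambda>t. (fst (x t), fst (snd (x t)), fst (snd (snd (x t))),
      fst (snd (snd (snd (x t)))), snd (snd (snd (snd (x t))))))"
    by simp
  show ?thesis
    by (rule that[OF x]) (unfold_locales, use assms kappa_values in auto)
qed

lemma stable_manifold_eq:
  assumes \<kappa>: "\<kappa> \<in> {kappa_abs, - kappa_abs}" and pos: "\<kappa> * c > 0"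
  shows "stable_manifold euler_field (equilibrium c) = ellipsoid \<kappa> c - {equilibrium (- c)}"
proof (intro equalityI subsetI)
  fix p assume "p \<in> stable_manifold euler_field (equilibrium c)"
  then obtain x where x: "p = x 0" "solves euler_field x {0..}" "(x \<longlongrightarrow> equilibrium c) at_top"
    by (auto simp: stable_manifold_def)
  obtain w1 w2 w3 w4 wp where
    x_eq: "x = (\<lambda>t. (w1 t, w2 t, w3 t, w4 t, wp t))" and "converging_solution w1 w2 w3 w4 wp \<kappa> c"
    by (rule converging_solution_components[OF x(2,3) \<kappa> pos])
  then interpret converging_solution w1 w2 w3 w4 wp \<kappa> c by simp
  show "p \<in> ellipsoid \<kappa> c - {equilibrium (- c)}"
    using in_ellipsoid[of 0] not_antipode[of 0] by (simp add: x(1) x_eq)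
next
  fix p assume p: "p \<in> ellipsoid \<kappa> c - {equilibrium (- c)}"
  show "p \<in> stable_manifold euler_field (equilibrium c)"
  proof (cases "p = equilibrium c")
    case True
    then show ?thesis
      using constant_solves[of c "{0..}"] by (auto simp: stable_manifold_def)
  next
    case False
    have "c \<noteq> 0" using pos by auto
    then have "p \<in> orbit_family c \<kappa>"
      using p False by (simp add: orbit_family_eq[OF _ \<kappa>])
    then obtain \<tau>0 \<theta>0 s where p_eq: "p = orb c \<kappa> \<tau>0 \<theta>0 s"
      by (auto simp: orbit_family_def)
    \<comment> \<open>The manifold is defined by initial values; the time shift by \<open>s\<close> is absorbed by \<open>\<tau>\<^sub>0\<close>.\<close>
    define \<tau>1 where "\<tau>1 = \<kappa> * c * s + \<tau>0"
    have "tau c \<kappa> \<tau>1 0 = tau c \<kappa> \<tau>0 s" by (simp add: tau_def \<tau>1_def)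
    then have "p = orb c \<kappa> \<tau>1 \<theta>0 0"
      by (simp add: p_eq orb_def orb_r_def orb_rho_def orb_theta_def orb_vartheta_def)
    then show ?thesis
      using orb_solves[OF \<kappa>] orb_limits(1)[OF \<kappa> pos] by (auto simp: stable_manifold_def)
  qed
qed

text \<open>The symmetry that reverses the flow: \<open>\<omega>\<^sub>p\<close> enters the first four equations as a factor and is absent
  from the right-hand side of the fifth.\<close>

definition time_reversal :: "phase \<Rightarrow> phase" where
  "time_reversal = (\<lambda>(w1, w2, w3, w4, wp). (w1, w2, w3, w4, - wp))"

lemma time_reversal_involution [simp]: "time_reversal (time_reversal p) = p"
  by (cases p) (simp add: time_reversal_def)

lemma time_reversal_linear: "bounded_linear time_reversal"
proof -
  have "time_reversal = (\<lambda>p. (fst p, fst (snd p), fst (snd (snd p)), fst (snd (snd (snd p))), - snd (snd (snd (snd p)))))"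
    by (simp add: time_reversal_def fun_eq_iff)
  moreover have "bounded_linear \<dots>"
    by (intro bounded_linear_minus bounded_linear_intros)
  ultimately show ?thesis by simp
qed

lemma time_reversal_dist: "dist (time_reversal p) (time_reversal q) = dist p q"
  by (cases p; cases q) (simp add: time_reversal_def dist_Pair_Pair dist_minus)

lemma time_reversal_equilibrium: "time_reversal (equilibrium c) = equilibrium (- c)"
  by (simp add: time_reversal_def equilibrium_def)

lemma time_reversal_ellipsoid: "time_reversal p \<in> ellipsoid \<kappa> c \<longleftrightarrow> p \<in> ellipsoid \<kappa> (- c)"
  by (cases p) (simp add: time_reversal_def ellipsoid_def)

lemma time_reversal_field: "euler_field (time_reversal p) = - time_reversal (euler_field p)"
  by (cases p) (simp add: time_reversal_def euler_field_def)

lemma time_reversal_solves: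
  assumes "solves euler_field x T" "\<And>t. t \<in> T' \<longleftrightarrow> - t \<in> T"
  shows "solves euler_field (\<lambda>t. time_reversal (x (- t))) T'"
  unfolding solves_def
proof
  fix t assume t: "t \<in> T'"
  have T: "uminus ` T' = T"
  proof (intro equalityI subsetI)
    fix s assume "s \<in> T"
    then have "- s \<in> T'" using assms(2)[of "- s"] by simp
    from imageI[OF this, of uminus] show "s \<in> uminus ` T'" by simp
  qed (use assms(2) in auto)
  have "(x has_vector_derivative euler_field (x (- t))) (at (- t) within uminus ` T')"
    using assms t by (simp add: solves_def T)
  moreover have "(uminus has_vector_derivative - 1) (at t within T')"
    by (auto intro!: derivative_eq_intros simp: has_vector_derivative_def)
  ultimately have "((x \<circ> uminus) has_vector_derivative (- 1) *\<^sub>R euler_field (x (- t))) (at t within T')"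
    by (intro vector_diff_chain_within)
  then have "((\<lambda>t. time_reversal (x (- t))) has_vector_derivative
      time_reversal (- euler_field (x (- t)))) (at t within T')"
    using bounded_linear.has_vector_derivative[OF time_reversal_linear] by (simp add: o_def)
  then show "((\<lambda>t. time_reversal (x (- t))) has_vector_derivative
      euler_field (time_reversal (x (- t)))) (at t within T')"
    by (simp add: time_reversal_field linear_neg[OF bounded_linear.linear[OF time_reversal_linear]])
qed

lemma time_reversal_tendsto:
  assumes "(x \<longlongrightarrow> equilibrium c) F" "filterlim uminus F F'"
  shows "((\<lambda>t. time_reversal (x (- t))) \<longlongrightarrow> equilibrium (- c)) F'"
  using bounded_linear.tendsto[OF time_reversal_linear filterlim_compose[OF assms]]
  by (simp add: time_reversal_equilibrium)

lemma unstable_manifold_eq_reversed: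
  "unstable_manifold euler_field (equilibrium c) =
    time_reversal ` stable_manifold euler_field (equilibrium (- c))"
proof (intro equalityI subsetI)
  fix p assume "p \<in> unstable_manifold euler_field (equilibrium c)"
  then obtain x where x: "p = x 0" "solves euler_field x {..0}" "(x \<longlongrightarrow> equilibrium c) at_bot"
    by (auto simp: unstable_manifold_def)
  have "time_reversal p \<in> stable_manifold euler_field (equilibrium (- c))"
    unfolding stable_manifold_def mem_Collect_eq
    by (rule exI[of _ "\<lambda>t. time_reversal (x (- t))"])
      (auto intro!: time_reversal_solves[OF x(2)] time_reversal_tendsto[OF x(3)] filterlim_uminus_at_bot_at_top simp: x(1))
  then show "p \<in> time_reversal ` stable_manifold euler_field (equilibrium (- c))"
    by (metis time_reversal_involution image_eqI)
next
  fix p assume "p \<in> time_reversal ` stable_manifold euler_field (equilibrium (- c))"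
  then obtain x where x: "p = time_reversal (x 0)" "solves euler_field x {0..}"
      "(x \<longlongrightarrow> equilibrium (- c)) at_top"
    by (auto simp: stable_manifold_def)
  show "p \<in> unstable_manifold euler_field (equilibrium c)"
    unfolding unstable_manifold_def mem_Collect_eq
    using time_reversal_tendsto[OF x(3) filterlim_uminus_at_top_at_bot]
    by (intro exI[of _ "\<lambda>t. time_reversal (x (- t))"])
      (auto intro!: time_reversal_solves[OF x(2)] simp: x(1))
qed

text \<open>The reversal exchanges the two poles and maps the ellipsoid to itself.\<close>

lemma unstable_manifold_eq:
  assumes \<kappa>: "\<kappa> \<in> {kappa_abs, - kappa_abs}" and neg: "\<kappa> * c < 0"
  shows "unstable_manifold euler_field (equilibrium c) = ellipsoid \<kappa> c - {equilibrium (- c)}"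
proof -
  have "stable_manifold euler_field (equilibrium (- c)) = ellipsoid \<kappa> (- c) - {equilibrium c}"
    using stable_manifold_eq[OF \<kappa>, of "- c"] neg by simp
  moreover have "time_reversal ` (ellipsoid \<kappa> (- c) - {equilibrium c}) = ellipsoid \<kappa> c - {equilibrium (- c)}"
  proof (intro equalityI subsetI)
    fix p assume "p \<in> time_reversal ` (ellipsoid \<kappa> (- c) - {equilibrium c})"
    then obtain q where q: "p = time_reversal q" "q \<in> ellipsoid \<kappa> (- c)" "q \<noteq> equilibrium c" by blast
    have "p \<noteq> equilibrium (- c)"
    proof
      assume "p = equilibrium (- c)"
      then have "time_reversal p = equilibrium c" by (simp add: time_reversal_equilibrium)
      with q show False by simp
    qed
    with q show "p \<in> ellipsoid \<kappa> c - {equilibrium (- c)}" by (simp add: time_reversal_ellipsoid)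
  next
    fix p assume p: "p \<in> ellipsoid \<kappa> c - {equilibrium (- c)}"
    have "time_reversal p \<noteq> equilibrium c"
    proof
      assume "time_reversal p = equilibrium c"
      then have "time_reversal (time_reversal p) = equilibrium (- c)" by (simp only: time_reversal_equilibrium)
      with p show False by simp
    qed
    with p have "time_reversal p \<in> ellipsoid \<kappa> (- c) - {equilibrium c}"
      by (simp add: time_reversal_ellipsoid)
    from imageI[OF this, of time_reversal]
    show "p \<in> time_reversal ` (ellipsoid \<kappa> (- c) - {equilibrium c})" by simp
  qed
  ultimately show ?thesis by (simp add: unstable_manifold_eq_reversed)
qed

section \<open>The punctured ellipsoid is a surface\<close>

definition ellipsoid_plane :: "real \<Rightarrow> real \<times> real \<Rightarrow> phase" where
  "ellipsoid_plane \<kappa> v = (fst v, 2 * \<kappa> * fst v - snd v / 2, - fst v / 2 - 2 * \<kappa> * snd v, snd v, 0)"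

text \<open>Stereographic projection of the ellipsoid from the pole \<open>equilibrium (- c)\<close>, with the projection plane
  parametrized by \<open>(\<omega>\<^sub>1, \<omega>\<^sub>4)\<close>. Writing it as a scalar factor times an affine map, based at the pole,
  keeps its derivative short.\<close>

definition stereo_factor :: "real \<Rightarrow> real \<times> real \<Rightarrow> real" where
  "stereo_factor c v = 2 * c\<^sup>2 / (c\<^sup>2 + 8 / 5 * (v \<bullet> v))"

definition stereo :: "real \<Rightarrow> real \<Rightarrow> real \<times> real \<Rightarrow> phase" where
  "stereo \<kappa> c v = stereo_factor c v *\<^sub>R (ellipsoid_plane \<kappa> v + equilibrium c) - equilibrium c"

definition stereo_inv :: "real \<Rightarrow> phase \<Rightarrow> real \<times> real" where
  "stereo_inv c = (\<lambda>(w1, w2, w3, w4, wp). (c / (c + wp) * w1, c / (c + wp) * w4))"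

lemma ellipsoid_plane_linear: "bounded_linear (ellipsoid_plane \<kappa>)"
  unfolding linear_conv_bounded_linear[symmetric]
  by (rule linearI) (auto simp: ellipsoid_plane_def algebra_simps add_divide_distrib diff_divide_distrib)

lemma stereo_denominator_pos: "c \<noteq> 0 \<Longrightarrow> c\<^sup>2 + 8 / 5 * (v \<bullet> v) > (0::real)"
  by (intro add_pos_nonneg) auto

lemma stereo_factor_nonzero: "c \<noteq> 0 \<Longrightarrow> stereo_factor c v \<noteq> 0"
  using stereo_denominator_pos[of c v] by (simp add: stereo_factor_def)

lemma stereo_coordinates:
  "stereo \<kappa> c v = (let G = stereo_factor c v; x = fst v; y = snd v in
     (G * x, 2 * \<kappa> * (G * x) - G * y / 2, - (G * x) / 2 - 2 * \<kappa> * (G * y), G * y, c * (G - 1)))"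
  by (simp add: stereo_def ellipsoid_plane_def equilibrium_def Let_def algebra_simps)

lemma stereo_inverse:
  assumes "c \<noteq> 0"
  shows "stereo_inv c (stereo \<kappa> c v) = v"
proof -
  have "c + c * (stereo_factor c v - 1) = c * stereo_factor c v" by (simp add: algebra_simps)
  then show ?thesis
    using assms stereo_factor_nonzero[OF assms, of v]
    by (cases v) (simp add: stereo_inv_def stereo_coordinates Let_def)
qed

lemma stereo_in_ellipsoid:
  assumes c: "c \<noteq> 0"
  shows "stereo \<kappa> c v \<in> ellipsoid \<kappa> c - {equilibrium (- c)}"
proof -
  obtain x y where v: "v = (x, y)" by (cases v)
  define G where "G = stereo_factor c (x, y)"
  have G0: "G \<noteq> 0" using stereo_factor_nonzero[OF c] by (simp add: G_def)
  have "G * (c\<^sup>2 + 8 / 5 * (x\<^sup>2 + y\<^sup>2)) = 2 * c\<^sup>2"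
    using stereo_denominator_pos[OF c, of v] by (simp add: G_def stereo_factor_def v power2_eq_square)
  then have "G * (G * (c\<^sup>2 + 8 / 5 * (x\<^sup>2 + y\<^sup>2)) - 2 * c\<^sup>2) = 0" by simp
  then have "(c * (G - 1))\<^sup>2 + 8 / 5 * ((G * x)\<^sup>2 + (G * y)\<^sup>2) = c\<^sup>2"
    by (simp add: power2_eq_square algebra_simps add_divide_distrib)
  then have "stereo \<kappa> c v \<in> ellipsoid \<kappa> c"
    unfolding stereo_coordinates Let_def G_def[symmetric] v fst_conv snd_conv
      ellipsoid_def mem_Collect_eq prod.case by blast
  moreover have "stereo \<kappa> c v \<noteq> equilibrium (- c)"
    using c G0 by (auto simp: v stereo_coordinates Let_def equilibrium_def G_def[symmetric] algebra_simps)
  ultimately show ?thesis by simp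
qed

lemma ellipsoid_wp_not_antipodal:
  assumes "(w1, w2, w3, w4, wp) \<in> ellipsoid \<kappa> c - {equilibrium (- c)}"
  shows "c + wp \<noteq> 0"
proof
  assume "c + wp = 0"
  then have wp: "wp = - c" by simp
  have "x = 0" if "(- c)\<^sup>2 + 8 / 5 * x = c\<^sup>2" for x
    using that by simp
  moreover have "(- c)\<^sup>2 + 8 / 5 * (w1\<^sup>2 + w4\<^sup>2) = c\<^sup>2"
    using assms unfolding wp ellipsoid_def by blast
  ultimately have "w1\<^sup>2 + w4\<^sup>2 = 0" .
  then have "w1 = 0" "w4 = 0" by (simp_all add: sum_power2_eq_zero_iff)
  then show False
    using assms wp by (auto simp: ellipsoid_def equilibrium_def)
qed

lemma stereo_surjective:
  assumes c: "c \<noteq> 0" and p: "p \<in> ellipsoid \<kappa> c - {equilibrium (- c)}"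
  shows "stereo \<kappa> c (stereo_inv c p) = p"
proof -
  obtain w1 w2 w3 w4 wp where p_eq: "p = (w1, w2, w3, w4, wp)" by (cases p) auto
  have w23: "w2 = 2 * \<kappa> * w1 - w4 / 2" "w3 = - w1 / 2 - 2 * \<kappa> * w4"
    and inv: "wp\<^sup>2 + 8 / 5 * (w1\<^sup>2 + w4\<^sup>2) = c\<^sup>2"
    using p by (auto simp: p_eq ellipsoid_def)
  define q where "q = c / (c + wp)"
  have s0: "c + wp \<noteq> 0" using ellipsoid_wp_not_antipodal p p_eq by blast
  then have q0: "q \<noteq> 0" using c by (simp add: q_def)
  have r_sq: "8 / 5 * (w1\<^sup>2 + w4\<^sup>2) = (c - wp) * (c + wp)"
    using inv by (simp add: power2_eq_square algebra_simps)
  have "c\<^sup>2 + 8 / 5 * ((q * w1)\<^sup>2 + (q * w4)\<^sup>2) = c\<^sup>2 + q\<^sup>2 * (8 / 5 * (w1\<^sup>2 + w4\<^sup>2))"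
    by (simp add: power_mult_distrib algebra_simps)
  also have "\<dots> = c\<^sup>2 + q\<^sup>2 * ((c - wp) * (c + wp))"
    by (simp only: r_sq)
  also have "\<dots> = 2 * c\<^sup>2 * q"
    using s0 by (simp add: q_def power2_eq_square divide_simps) (simp add: algebra_simps)
  finally have "stereo_factor c (q * w1, q * w4) = 1 / q"
    using c q0 by (simp add: stereo_factor_def flip: power2_eq_square)
  moreover have "c * (1 / q - 1) = wp" using s0 c by (simp add: q_def field_simps)
  moreover have "stereo_inv c p = (q * w1, q * w4)" by (simp add: p_eq stereo_inv_def q_def)
  ultimately show ?thesis
    using q0 by (simp add: p_eq stereo_coordinates Let_def w23)
qed

lemma stereo_factor_deriv:
  assumes "c \<noteq> 0"
  shows "(stereo_factor c has_derivative
    (\<lambda>h. - (32 / 5 * c\<^sup>2 / (c\<^sup>2 + 8 / 5 * (v \<bullet> v))\<^sup>2) * (v \<bullet> h))) (at v)"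
  unfolding stereo_factor_def[abs_def] using stereo_denominator_pos[OF assms, of v]
  by (auto intro!: derivative_eq_intros simp: inner_commute power2_eq_square field_simps)

definition stereo_deriv :: "real \<Rightarrow> real \<Rightarrow> real \<times> real \<Rightarrow> real \<times> real \<Rightarrow> phase" where
  "stereo_deriv \<kappa> c v h =
     (- (32 / 5 * c\<^sup>2 / (c\<^sup>2 + 8 / 5 * (v \<bullet> v))\<^sup>2) * (v \<bullet> h)) *\<^sub>R (ellipsoid_plane \<kappa> v + equilibrium c)
     + stereo_factor c v *\<^sub>R ellipsoid_plane \<kappa> h"

lemma stereo_has_derivative:
  assumes "c \<noteq> 0"
  shows "(stereo \<kappa> c has_derivative stereo_deriv \<kappa> c v) (at v)"
  unfolding stereo_def[abs_def] stereo_deriv_def[abs_def]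
  by (rule derivative_eq_intros stereo_factor_deriv[OF assms]
      bounded_linear_imp_has_derivative[OF ellipsoid_plane_linear] refl)+
    (simp add: add.commute)

text \<open>The last coordinate of the derivative is \<open>c\<close> times the derivative of the scalar factor; if it
  vanishes, only a nonzero multiple of the injective map \<open>ellipsoid_plane\<close> remains.\<close>

lemma stereo_deriv_inj:
  assumes "c \<noteq> 0"
  shows "inj (stereo_deriv \<kappa> c v)"
proof -
  have lin: "linear (stereo_deriv \<kappa> c v)"
    using stereo_has_derivative[OF assms] has_derivative_linear by blast
  show ?thesis
    unfolding linear_injective_0[OF lin]
  proof (intro allI impI)
    fix h assume h: "stereo_deriv \<kappa> c v h = 0"
    define g where "g = - (32 / 5 * c\<^sup>2 / (c\<^sup>2 + 8 / 5 * (v \<bullet> v))\<^sup>2) * (v \<bullet> h)"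
    have eq: "g *\<^sub>R (ellipsoid_plane \<kappa> v + equilibrium c) + stereo_factor c v *\<^sub>R ellipsoid_plane \<kappa> h = 0"
      using h by (simp add: stereo_deriv_def g_def)
    then have "g * c = 0"
      by (simp add: ellipsoid_plane_def equilibrium_def zero_prod_def)
    then have "g = 0" using assms by simp
    with eq have "ellipsoid_plane \<kappa> h = 0"
      using stereo_factor_nonzero[OF assms] by simp
    then show "h = 0"
      by (cases h) (simp add: ellipsoid_plane_def zero_prod_def)
  qed
qed

lemma two_dim_punctured_ellipsoid:
  assumes c: "c \<noteq> 0"
  shows "two_dim_submanifold (ellipsoid \<kappa> c - {equilibrium (- c)})" (is "two_dim_submanifold ?M")
proof -
  have bl: "blinfun_apply (Blinfun (stereo_deriv \<kappa> c v)) = stereo_deriv \<kappa> c v" for v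
    by (rule bounded_linear_Blinfun_apply[OF has_derivative_bounded_linear[OF stereo_has_derivative[OF c]]])
  have hom: "homeomorphism UNIV ?M (stereo \<kappa> c) (stereo_inv c)"
  proof (rule homeomorphismI)
    show "continuous_on UNIV (stereo \<kappa> c)"
      by (intro continuous_at_imp_continuous_on ballI)
        (rule has_derivative_continuous[OF stereo_has_derivative[OF c]])
    have "c + snd (snd (snd (snd p))) \<noteq> 0" if "p \<in> ?M" for p
    proof -
      obtain w1 w2 w3 w4 wp where p: "p = (w1, w2, w3, w4, wp)" by (cases p) auto
      show ?thesis using ellipsoid_wp_not_antipodal[OF that[unfolded p]] by (simp add: p)
    qed
    then show "continuous_on ?M (stereo_inv c)"
      unfolding stereo_inv_def case_prod_unfold by (intro continuous_intros) auto
      show "stereo \<kappa> c ` UNIV \<subseteq> ?M"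
      by (intro image_subsetI stereo_in_ellipsoid[OF c])
  qed (use stereo_inverse[OF c] stereo_surjective[OF c] in blast)+
  have "continuous_on UNIV (\<lambda>v. Blinfun (stereo_deriv \<kappa> c v))"
  proof (rule continuous_on_blinfun_componentwise)
    fix i :: "real \<times> real"
    have nz: "c\<^sup>2 + 8 / 5 * (v \<bullet> v) \<noteq> 0" for v :: "real \<times> real"
      by (rule less_imp_neq[OF stereo_denominator_pos[OF c], symmetric])
    show "continuous_on UNIV (\<lambda>v. blinfun_apply (Blinfun (stereo_deriv \<kappa> c v)) i)"
      unfolding bl stereo_deriv_def stereo_factor_def
      by (intro continuous_intros linear_continuous_on ellipsoid_plane_linear ballI power_not_zero nz)
  qed
  then show ?thesis
    unfolding two_dim_submanifold_def
    by (intro ballI exI[of _ UNIV] exI[of _ "stereo \<kappa> c"] exI[of _ "stereo_inv c"]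
        exI[of _ "\<lambda>v. Blinfun (stereo_deriv \<kappa> c v)"])
      (simp add: bl hom stereo_has_derivative[OF c] stereo_deriv_inj[OF c])
qed

section \<open>Dimension, rate and parametrization of the manifolds\<close>

lemma kappa_of_sign:
  assumes "c \<noteq> 0"
  obtains \<kappa> where "\<kappa> \<in> {kappa_abs, - kappa_abs}" "\<kappa> * c > 0"
proof -
  have "kappa_abs > 0" by (simp add: kappa_abs_eq)
  then show ?thesis
    using that[of kappa_abs] that[of "- kappa_abs"] assms by (cases "c > 0") (auto simp: mult_neg_pos mult_pos_neg mult_less_0_iff)
qed

lemma stable_exponential:
  assumes "c \<noteq> 0" "solves euler_field x {0..}" "(x \<longlongrightarrow> equilibrium c) at_top"
  shows "\<exists>C a. a > 0 \<and> (\<forall>t\<ge>0. dist (x t) (equilibrium c) \<le> C * exp (- a * t))"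
proof -
  obtain \<kappa> where \<kappa>: "\<kappa> \<in> {kappa_abs, - kappa_abs}" "\<kappa> * c > 0" by (rule kappa_of_sign[OF assms(1)])
  obtain w1 w2 w3 w4 wp where
    x_eq: "x = (\<lambda>t. (w1 t, w2 t, w3 t, w4 t, wp t))" and "converging_solution w1 w2 w3 w4 wp \<kappa> c"
    by (rule converging_solution_components[OF assms(2,3) \<kappa>])
  then show ?thesis
    using converging_solution.exponential_convergence by (simp add: x_eq)
qed

lemma unstable_exponential:
  assumes "c \<noteq> 0" "solves euler_field x {..0}" "(x \<longlongrightarrow> equilibrium c) at_bot"
  shows "\<exists>C a. a > 0 \<and> (\<forall>t\<le>0. dist (x t) (equilibrium c) \<le> C * exp (a * t))"
proof -
  have "solves euler_field (\<lambda>t. time_reversal (x (- t))) {0..}"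
    by (rule time_reversal_solves[OF assms(2)]) auto
  moreover have "((\<lambda>t. time_reversal (x (- t))) \<longlongrightarrow> equilibrium (- c)) at_top"
    by (rule time_reversal_tendsto[OF assms(3) filterlim_uminus_at_bot_at_top])
  moreover have "- c \<noteq> 0" using assms(1) by simp
  ultimately have "\<exists>C a. a > 0 \<and>
      (\<forall>t\<ge>0. dist (time_reversal (x (- t))) (equilibrium (- c)) \<le> C * exp (- a * t))"
    by (intro stable_exponential)
  then obtain C a where "a > 0"
    and bound: "\<And>t. t \<ge> 0 \<Longrightarrow> dist (time_reversal (x (- t))) (equilibrium (- c)) \<le> C * exp (- a * t)"
    by blast
  have "dist (x t) (equilibrium c) \<le> C * exp (a * t)" if "t \<le> 0" for t
    using bound[of "- t"] that by (simp add: time_reversal_dist flip: time_reversal_equilibrium)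
  with \<open>a > 0\<close> show ?thesis by blast
qed

lemma manifolds_two_dim:
  assumes "c \<noteq> 0"
  shows "two_dim_submanifold (stable_manifold euler_field (equilibrium c))"
    and "two_dim_submanifold (unstable_manifold euler_field (equilibrium c))"
proof -
  obtain \<kappa> where \<kappa>: "\<kappa> \<in> {kappa_abs, - kappa_abs}" "\<kappa> * c > 0" by (rule kappa_of_sign[OF assms])
  show "two_dim_submanifold (stable_manifold euler_field (equilibrium c))"
    by (simp only: stable_manifold_eq[OF \<kappa>] two_dim_punctured_ellipsoid[OF assms])
  have "- \<kappa> \<in> {kappa_abs, - kappa_abs}" "- \<kappa> * c < 0" using \<kappa> by auto
  then show "two_dim_submanifold (unstable_manifold euler_field (equilibrium c))"
    by (simp only: unstable_manifold_eq two_dim_punctured_ellipsoid[OF assms])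
qed

lemma manifolds_eq_orbit_family:
  assumes \<kappa>: "\<kappa> \<in> {kappa_abs, - kappa_abs}"
  shows "\<kappa> * \<Gamma> > 0 \<Longrightarrow> stable_manifold euler_field (equilibrium \<Gamma>) - {equilibrium \<Gamma>} = orbit_family \<Gamma> \<kappa>"
    and "\<kappa> * \<Gamma> > 0 \<Longrightarrow> unstable_manifold euler_field (equilibrium (- \<Gamma>)) - {equilibrium (- \<Gamma>)} = orbit_family \<Gamma> \<kappa>"
    and "\<kappa> * \<Gamma> < 0 \<Longrightarrow> unstable_manifold euler_field (equilibrium \<Gamma>) - {equilibrium \<Gamma>} = orbit_family \<Gamma> \<kappa>"
    and "\<kappa> * \<Gamma> < 0 \<Longrightarrow> stable_manifold euler_field (equilibrium (- \<Gamma>)) - {equilibrium (- \<Gamma>)} = orbit_family \<Gamma> \<kappa>"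
proof -
  have even: "ellipsoid \<kappa> (- \<Gamma>) = ellipsoid \<kappa> \<Gamma>" by (simp add: ellipsoid_def)
  have family: "orbit_family \<Gamma> \<kappa> = ellipsoid \<kappa> \<Gamma> - {equilibrium (- \<Gamma>)} - {equilibrium \<Gamma>}"
    "orbit_family \<Gamma> \<kappa> = ellipsoid \<kappa> \<Gamma> - {equilibrium \<Gamma>} - {equilibrium (- \<Gamma>)}" if "\<Gamma> \<noteq> 0"
    using that orbit_family_eq[OF _ \<kappa>, of \<Gamma>] by (simp_all add: insert_commute flip: Diff_insert)
  show "stable_manifold euler_field (equilibrium \<Gamma>) - {equilibrium \<Gamma>} = orbit_family \<Gamma> \<kappa>" if "\<kappa> * \<Gamma> > 0"
    using stable_manifold_eq[OF \<kappa> that] family(1) that by (cases "\<Gamma> = 0") simp_all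
  show "unstable_manifold euler_field (equilibrium (- \<Gamma>)) - {equilibrium (- \<Gamma>)} = orbit_family \<Gamma> \<kappa>" if "\<kappa> * \<Gamma> > 0"
    using unstable_manifold_eq[OF \<kappa>, of "- \<Gamma>"] family(2) that by (cases "\<Gamma> = 0") (simp_all add: even)
  show "unstable_manifold euler_field (equilibrium \<Gamma>) - {equilibrium \<Gamma>} = orbit_family \<Gamma> \<kappa>" if "\<kappa> * \<Gamma> < 0"
    using unstable_manifold_eq[OF \<kappa> that] family(1) that by (cases "\<Gamma> = 0") simp_all
  show "stable_manifold euler_field (equilibrium (- \<Gamma>)) - {equilibrium (- \<Gamma>)} = orbit_family \<Gamma> \<kappa>" if "\<kappa> * \<Gamma> < 0"
    using stable_manifold_eq[OF \<kappa>, of "- \<Gamma>"] family(2) that by (cases "\<Gamma> = 0") (simp_all add: even)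
qed

lemma infdist_tendsto_zero:
  assumes "(x \<longlongrightarrow> q) F" "q \<in> S"
  shows "((\<lambda>t. infdist (x t) S) \<longlongrightarrow> 0) F"
  using tendsto_infdist[OF assms(1), of S] assms(2) by simp

lemma orb_asymptotic_to_line:
  assumes "\<Gamma> \<noteq> 0" "\<kappa> \<in> {kappa_abs, - kappa_abs}"
  shows "((\<lambda>t. infdist (orb \<Gamma> \<kappa> \<tau>0 \<theta>0 t) fixed_line) \<longlongrightarrow> 0) at_top"
    and "((\<lambda>t. infdist (orb \<Gamma> \<kappa> \<tau>0 \<theta>0 t) fixed_line) \<longlongrightarrow> 0) at_bot"
proof -
  have "\<kappa> * \<Gamma> \<noteq> 0"
    using assms(1) kappa_values(2)[OF assms(2)] by simp
  then consider "\<kappa> * \<Gamma> > 0" | "\<kappa> * \<Gamma> < 0" by linarith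
  then show "((\<lambda>t. infdist (orb \<Gamma> \<kappa> \<tau>0 \<theta>0 t) fixed_line) \<longlongrightarrow> 0) at_top"
    "((\<lambda>t. infdist (orb \<Gamma> \<kappa> \<tau>0 \<theta>0 t) fixed_line) \<longlongrightarrow> 0) at_bot"
    by (cases; metis infdist_tendsto_zero orb_limits[OF assms(2)] equilibrium_in_line)+
qed

lemma kappa_as_cosine:
  assumes "\<kappa> \<in> {kappa_abs, - kappa_abs}"
  shows "\<kappa> = sqrt (- A1 * A2) * cos (orb_theta \<Gamma> \<kappa> \<tau>0 \<theta>0 t + orb_vartheta \<Gamma> \<kappa> \<tau>0 \<theta>0 t)"
proof -
  have "sqrt (- A1 * A2) = sqrt (3 / 5) / 2"
    using real_sqrt_divide[of "3 / 5" 4] by (simp add: A1_def A2_def)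
  moreover have "\<kappa> = sqrt (3 / 5) / 2 * cos (angle_sum \<kappa>)"
    using angle_sum_trig(1)[OF assms] by simp
  ultimately show ?thesis
    by (simp only: orb_vartheta_def) simp
qed

theorem mainTheorem1:
  fixes \<Gamma> :: real
  assumes "\<Gamma> \<noteq> 0"
  shows
    "(\<forall>q\<in>fixed_line. euler_field q = 0) \<and>
     (\<forall>q\<in>{equilibrium \<Gamma>, - equilibrium \<Gamma>}.
        q \<in> fixed_line \<and>
        two_dim_submanifold (stable_manifold euler_field q) \<and>
        two_dim_submanifold (unstable_manifold euler_field q) \<and>
        (\<forall>x. solves euler_field x {0..} \<and> (x \<longlongrightarrow> q) at_top \<longrightarrow>
           (\<exists>C a. a > 0 \<and> (\<forall>t\<ge>0. dist (x t) q \<le> C * exp (- a * t)))) \<and>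
        (\<forall>x. solves euler_field x {..0} \<and> (x \<longlongrightarrow> q) at_bot \<longrightarrow>
           (\<exists>C a. a > 0 \<and> (\<forall>t\<le>0. dist (x t) q \<le> C * exp (a * t))))) \<and>
     (\<forall>\<kappa>\<in>{kappa_abs, - kappa_abs}.
        (\<kappa> * \<Gamma> > 0 \<longrightarrow>
           stable_manifold euler_field (equilibrium \<Gamma>) - {equilibrium \<Gamma>} = orbit_family \<Gamma> \<kappa> \<and>
           unstable_manifold euler_field (- equilibrium \<Gamma>) - {- equilibrium \<Gamma>} = orbit_family \<Gamma> \<kappa>) \<and>
        (\<kappa> * \<Gamma> < 0 \<longrightarrow>
           unstable_manifold euler_field (equilibrium \<Gamma>) - {equilibrium \<Gamma>} = orbit_family \<Gamma> \<kappa> \<and>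
           stable_manifold euler_field (- equilibrium \<Gamma>) - {- equilibrium \<Gamma>} = orbit_family \<Gamma> \<kappa>) \<and>
        (\<forall>\<tau>0 \<theta>0.
           solves euler_field (orb \<Gamma> \<kappa> \<tau>0 \<theta>0) UNIV \<and>
           ((\<lambda>t. infdist (orb \<Gamma> \<kappa> \<tau>0 \<theta>0 t) fixed_line) \<longlongrightarrow> 0) at_top \<and>
           ((\<lambda>t. infdist (orb \<Gamma> \<kappa> \<tau>0 \<theta>0 t) fixed_line) \<longlongrightarrow> 0) at_bot \<and>
           (\<forall>t. \<kappa> = sqrt (- A1 * A2) *
                    cos (orb_theta \<Gamma> \<kappa> \<tau>0 \<theta>0 t + orb_vartheta \<Gamma> \<kappa> \<tau>0 \<theta>0 t)) \<and>
           (\<forall>w0. (\<forall>t. (w0 has_real_derivative aux_field0 (orb \<Gamma> \<kappa> \<tau>0 \<theta>0 t)) (at t)) \<and>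
                 (w0 \<longlongrightarrow> 0) at_top \<and> (w0 \<longlongrightarrow> 0) at_bot
              \<longleftrightarrow> (\<forall>t. w0 t = omega0 \<Gamma> \<kappa> \<tau>0 \<theta>0 t)) \<and>
           (\<forall>w5. (\<forall>t. (w5 has_real_derivative aux_field5 (orb \<Gamma> \<kappa> \<tau>0 \<theta>0 t)) (at t)) \<and>
                 (w5 \<longlongrightarrow> 0) at_top \<and> (w5 \<longlongrightarrow> 0) at_bot
              \<longleftrightarrow> (\<forall>t. w5 t = omega5 \<Gamma> \<kappa> \<tau>0 \<theta>0 t))))"
proof -
  have equilibria: "q \<in> fixed_line \<and>
        two_dim_submanifold (stable_manifold euler_field q) \<and>
        two_dim_submanifold (unstable_manifold euler_field q) \<and>
        (\<forall>x. solves euler_field x {0..} \<and> (x \<longlongrightarrow> q) at_top \<longrightarrow>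
           (\<exists>C a. a > 0 \<and> (\<forall>t\<ge>0. dist (x t) q \<le> C * exp (- a * t)))) \<and>
        (\<forall>x. solves euler_field x {..0} \<and> (x \<longlongrightarrow> q) at_bot \<longrightarrow>
           (\<exists>C a. a > 0 \<and> (\<forall>t\<le>0. dist (x t) q \<le> C * exp (a * t))))"
    if q: "q \<in> {equilibrium \<Gamma>, - equilibrium \<Gamma>}" for q
  proof -
    obtain c where c: "c \<noteq> 0" "q = equilibrium c"
      using q assms by (cases "q = equilibrium \<Gamma>") (auto simp: equilibrium_minus intro: that[of "- \<Gamma>"])
    show ?thesis
      unfolding c(2)
      by (intro conjI allI impI equilibrium_in_line manifolds_two_dim[OF c(1)])
        (elim conjE, erule (1) stable_exponential[OF c(1)] unstable_exponential[OF c(1)])+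
  qed
  show ?thesis
  proof (intro conjI ballI allI)
    fix \<kappa> \<tau>0 \<theta>0 t assume \<kappa>: "\<kappa> \<in> {kappa_abs, - kappa_abs}"
    note manifolds = manifolds_eq_orbit_family[OF \<kappa>, of \<Gamma>, folded equilibrium_minus]
    show "\<kappa> * \<Gamma> > 0 \<longrightarrow>
       stable_manifold euler_field (equilibrium \<Gamma>) - {equilibrium \<Gamma>} = orbit_family \<Gamma> \<kappa> \<and>
       unstable_manifold euler_field (- equilibrium \<Gamma>) - {- equilibrium \<Gamma>} = orbit_family \<Gamma> \<kappa>"
      by (intro impI conjI manifolds(1,2))
    show "\<kappa> * \<Gamma> < 0 \<longrightarrow>
       unstable_manifold euler_field (equilibrium \<Gamma>) - {equilibrium \<Gamma>} = orbit_family \<Gamma> \<kappa> \<and>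
       stable_manifold euler_field (- equilibrium \<Gamma>) - {- equilibrium \<Gamma>} = orbit_family \<Gamma> \<kappa>"
      by (intro impI conjI manifolds(3,4))
    show "solves euler_field (orb \<Gamma> \<kappa> \<tau>0 \<theta>0) UNIV"
      by (rule orb_solves[OF \<kappa>])
    show "((\<lambda>t. infdist (orb \<Gamma> \<kappa> \<tau>0 \<theta>0 t) fixed_line) \<longlongrightarrow> 0) at_top"
      "((\<lambda>t. infdist (orb \<Gamma> \<kappa> \<tau>0 \<theta>0 t) fixed_line) \<longlongrightarrow> 0) at_bot"
      by (rule orb_asymptotic_to_line[OF assms \<kappa>])+
    show "\<kappa> = sqrt (- A1 * A2) * cos (orb_theta \<Gamma> \<kappa> \<tau>0 \<theta>0 t + orb_vartheta \<Gamma> \<kappa> \<tau>0 \<theta>0 t)"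
      by (rule kappa_as_cosine[OF \<kappa>])
    have "\<kappa> * \<Gamma> \<noteq> 0" using assms kappa_values(2)[OF \<kappa>] by simp
    note sech = sech_tau_limits[OF this]
    show "(\<forall>t. (w0 has_real_derivative aux_field0 (orb \<Gamma> \<kappa> \<tau>0 \<theta>0 t)) (at t)) \<and>
        (w0 \<longlongrightarrow> 0) at_top \<and> (w0 \<longlongrightarrow> 0) at_bot \<longleftrightarrow> (\<forall>t. w0 t = omega0 \<Gamma> \<kappa> \<tau>0 \<theta>0 t)" for w0
      by (rule vanishing_antiderivative_unique[OF omega0_deriv[OF assms \<kappa>] omega_tendsto_zero(1)[OF sech(1)]
            omega_tendsto_zero(1)[OF sech(2)]])
    show "(\<forall>t. (w5 has_real_derivative aux_field5 (orb \<Gamma> \<kappa> \<tau>0 \<theta>0 t)) (at t)) \<and>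
        (w5 \<longlongrightarrow> 0) at_top \<and> (w5 \<longlongrightarrow> 0) at_bot \<longleftrightarrow> (\<forall>t. w5 t = omega5 \<Gamma> \<kappa> \<tau>0 \<theta>0 t)" for w5
      by (rule vanishing_antiderivative_unique[OF omega5_deriv[OF assms \<kappa>] omega_tendsto_zero(2)[OF sech(1)]
            omega_tendsto_zero(2)[OF sech(2)]])
  qed (use equilibria fixed_line_stationary in blast)+
qed

end
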